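(* Let $\mathfrak m$ be an uncountable cardinal with $\sup\{\mathfrak m^{\mathfrak n}:\mathfrak n<\mathfrak m\}=\mathfrak m$. Every metrizable SIN topological group of weight $\le\mathfrak m$ is isomorphic to a topological subgroup of $\mathrm{Iso}(\mathbb U_{\mathfrak m})$.
   Context: $\mathbb U_{\mathfrak m}$ is the Urysohn–Katětov space of weight $\mathfrak m$: the complete metric space of density $\mathfrak m$ containing an isometric copy of every metric space of weight $\le\mathfrak m$ and $\mathfrak m$-homogeneous (every isometry between subsets of cardinality $<\mathfrak m$ extends to an isometry of the whole space); $\mathrm{Iso}(\mathbb U_{\mathfrak m})$ carries the topology of pointwise convergence. A topological group is SIN if its left and right uniform structures coincide, equivalently if it has a neighbourhood base at the identity of conjugation-invariant sets. *)

theory Defs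
  imports "HOL-Analysis.Analysis" "HOL-Algebra.Group"
begin

unbundle cardinal_syntax

text \<open>Cardinal hypothesis on m = |K|:  sup{m^n : n < m} = m, i.e. every m^n with n < m is <= m
  (the sup is automatically >= m since m^1 = m). Cardinals n < m are realised as subsets of K's type.\<close>
definition sup_power_below_eq :: "'k set \<Rightarrow> bool" where
  "sup_power_below_eq K \<longleftrightarrow> (\<forall>N :: 'k set. |N| <o |K| \<longrightarrow> ( |K| ^c |N| ) \<le>o |K| )"

definition weight_le :: "'a topology \<Rightarrow> 'k set \<Rightarrow> bool" where
  "weight_le T K \<longleftrightarrow> (\<exists>B. (\<forall>U\<in>B. openin T U) \<and>
      (\<forall>U. openin T U \<longrightarrow> (\<exists>C\<subseteq>B. \<Union>C = U)) \<and> |B| \<le>o |K| )"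

definition density_eq :: "'a set \<Rightarrow> ('a \<Rightarrow> 'a \<Rightarrow> real) \<Rightarrow> 'k set \<Rightarrow> bool" where
  "density_eq M d K \<longleftrightarrow>
     (\<exists>D\<subseteq>M. Metric_space.mtopology M d closure_of D = M \<and> |D| =o |K| ) \<and>
     (\<forall>D\<subseteq>M. Metric_space.mtopology M d closure_of D = M \<longrightarrow> |K| \<le>o |D| )"

text \<open>The Urysohn--Katetov space of weight m = |K|: complete metric space of density m,
  containing an isometric copy of every metric space of weight <= m (metric spaces are taken
  with carrier a subset of the carrier type of the space; every metric space of weight <= m
  has cardinality <= m^aleph0 = m and so can be transported there), and m-homogeneous.\<close>
definition urysohn_katetov :: "'k set \<Rightarrow> 'a set \<Rightarrow> ('a \<Rightarrow> 'a \<Rightarrow> real) \<Rightarrow> bool" where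
  "urysohn_katetov K M d \<longleftrightarrow>
     Metric_space M d \<and> Metric_space.mcomplete M d \<and> density_eq M d K \<and>
     (\<forall>(X :: 'a set) e. Metric_space X e \<and> weight_le (Metric_space.mtopology X e) K \<longrightarrow>
        (\<exists>f. f ` X \<subseteq> M \<and> (\<forall>x\<in>X. \<forall>y\<in>X. d (f x) (f y) = e x y))) \<and>
     (\<forall>A h. A \<subseteq> M \<and> |A| <o |K| \<and> h ` A \<subseteq> M \<and> (\<forall>x\<in>A. \<forall>y\<in>A. d (h x) (h y) = d x y) \<longrightarrow>
        (\<exists>F. bij_betw F M M \<and> (\<forall>x\<in>M. \<forall>y\<in>M. d (F x) (F y) = d x y) \<and> (\<forall>x\<in>A. F x = h x)))"

definition Iso_group :: "'a set \<Rightarrow> ('a \<Rightarrow> 'a \<Rightarrow> real) \<Rightarrow> ('a \<Rightarrow> 'a) monoid" where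
  "Iso_group M d = \<lparr> carrier = {f \<in> M \<rightarrow>\<^sub>E M. bij_betw f M M \<and> (\<forall>x\<in>M. \<forall>y\<in>M. d (f x) (f y) = d x y)},
                     mult = (\<lambda>f g. compose M f g), one = restrict id M \<rparr>"

definition Iso_top :: "'a set \<Rightarrow> ('a \<Rightarrow> 'a \<Rightarrow> real) \<Rightarrow> ('a \<Rightarrow> 'a) topology" where
  "Iso_top M d = subtopology (product_topology (\<lambda>_. Metric_space.mtopology M d) M) (carrier (Iso_group M d))"

definition topological_group :: "('g, 'b) monoid_scheme \<Rightarrow> 'g topology \<Rightarrow> bool" where
  "topological_group G T \<longleftrightarrow> group G \<and> topspace T = carrier G \<and>
     continuous_map (prod_topology T T) T (\<lambda>(x, y). x \<otimes>\<^bsub>G\<^esub> y) \<and>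
     continuous_map T T (\<lambda>x. inv\<^bsub>G\<^esub> x)"

definition SIN :: "('g, 'b) monoid_scheme \<Rightarrow> 'g topology \<Rightarrow> bool" where
  "SIN G T \<longleftrightarrow> (\<forall>U. openin T U \<and> \<one>\<^bsub>G\<^esub> \<in> U \<longrightarrow>
     (\<exists>V. V \<subseteq> U \<and> \<one>\<^bsub>G\<^esub> \<in> T interior_of V \<and>
        (\<forall>g\<in>carrier G. \<forall>x\<in>V. g \<otimes>\<^bsub>G\<^esub> x \<otimes>\<^bsub>G\<^esub> inv\<^bsub>G\<^esub> g \<in> V)))"

end

theory Submission
  imports Defs
begin

text \<open>
  The Birkhoff--Kakutani chain construction, applied to conjugation-invariant neighbourhoods, yields a
  conjugation-invariant norm \<open>N\<close> inducing the topology of \<open>G\<close>. The metric space \<open>G\<close>, with \<open>G\<close> acting by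
  left translations, is then enlarged to a pseudometric space $G \times K$ by adjoining one free orbit
  at each stage of a transfinite recursion along \<open>K\<close>, the distances from the new point to the earlier
  ones being a Katetov function. Invariance of \<open>N\<close> ensures that every \<open>g\<close> displaces all points
  of the enlarged space by at most \<open>N g\<close>. The cardinal hypothesis allows every Katetov
  function on fewer than \<open>m\<close> points to be realised at some stage; it also makes the cardinality of
  $U_m$ equal to \<open>m\<close>, and universality with homogeneity gives $U_m$ the same exact extension property.
  So a back-and-forth argument of length \<open>m\<close> maps the enlarged space isometrically onto
  $U_m$, and the action is transported along this map. It is continuous since displacements are
  bounded by \<open>N\<close>, and a homeomorphism onto its image since it is isometric on one orbit.
\<close>

section \<open>Cardinal arithmetic\<close>

lemma in_underS_card_of_iff:
  "j \<in> underS |K| i \<longleftrightarrow> (j, i) \<in> |K| \<and> j \<noteq> i"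
  by (auto simp: underS_def)

lemma underS_card_of_subset: "underS |K| i \<subseteq> K"
proof
  fix j assume "j \<in> underS |K| i"
  then have "j \<in> Field |K|"
    by (auto simp: underS_def Field_def)
  then show "j \<in> K" by (simp add: Field_card_of)
qed

lemma wf_underS_card_of: "wf {(j, i). j \<in> underS |K| i}"
proof -
  have "{(j, i). j \<in> underS |K| i} = |K| - Id"
    by (auto simp: underS_def)
  then show ?thesis
    using card_of_well_order_on[of K] by (simp add: well_order_on_def)
qed

lemma underS_card_of_trans:
  assumes "i \<in> underS |K| j" "j \<in> underS |K| k"
  shows "i \<in> underS |K| k"
proof -
  have "trans |K|" "antisym |K|"
    using card_of_well_order_on[of K]
    by (simp_all add: well_order_on_def linear_order_on_def partial_order_on_def preorder_on_def)
  with assms show ?thesis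
    unfolding in_underS_card_of_iff by (meson antisymD transD)
qed

lemma underS_card_of_asym: "i \<in> underS |K| j \<Longrightarrow> j \<notin> underS |K| i"
  using underS_card_of_trans[of i K j i] by (auto simp: in_underS_card_of_iff)

lemma underS_card_of_total:
  assumes "i \<in> K" "j \<in> K"
  shows "i = j \<or> i \<in> underS |K| j \<or> j \<in> underS |K| i"
  using card_of_well_order_on[of K] assms
  by (auto simp: in_underS_card_of_iff well_order_on_def linear_order_on_def total_on_def)

lemma card_of_underS_card_of: "i \<in> K \<Longrightarrow> |underS |K| i| <o |K|"
  by (rule card_of_underS[OF card_of_Card_order]) (simp add: Field_card_of)

text \<open>\<open>sup_power_below_eq\<close> only speaks of exponents over the type of
  \<open>K\<close>, so \<open>N\<close> is first replaced by an equipotent subset of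
  \<open>K\<close>; the rest is monotonicity of the power in its base.\<close>

lemma card_of_Func_ordLeq:
  fixes K :: "'k set"
  assumes "sup_power_below_eq K" "|N| <o |K|" "|Z| \<le>o |K|"
  shows "|Func N Z| \<le>o |K|"
proof -
  obtain N' where N': "N' \<subseteq> K" "|N| =o |N'|"
    using internalize_card_of_ordLeq2[of N K] assms(2) ordLess_imp_ordLeq by blast
  then have "|N'| <o |K|"
    using assms(2) ordIso_ordLess_trans ordIso_symmetric by blast
  then have 1: "|K| ^c |N'| \<le>o |K|"
    using assms(1) by (simp add: sup_power_below_eq_def)
  have "|Z| ^c |N| \<le>o |K| ^c |N|"
    by (rule cexp_mono1[OF assms(3) card_of_Card_order])
  moreover have "|K| ^c |N| =o |K| ^c |N'|"
    by (rule cexp_cong2[OF N'(2) card_of_Card_order card_of_Card_order])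
  ultimately have "|Z| ^c |N| \<le>o |K|"
    using 1 ordLeq_ordIso_trans ordLeq_transitive by blast
  then show ?thesis
    by (simp add: cexp_def Field_card_of)
qed

lemma countable_iff_ordLeq_nat: "countable D \<longleftrightarrow> |D| \<le>o |UNIV :: nat set|"
  by (simp add: countable_def card_of_ordLeq[symmetric])

lemma nat_ordLess_uncountable: "uncountable K \<Longrightarrow> |UNIV :: nat set| <o |K|"
  unfolding countable_iff_ordLeq_nat
  using not_ordLeq_iff_ordLess[OF card_of_Well_order card_of_Well_order] by blast

text \<open>Koenig's diagonal argument: a cofinal map from a shorter segment would yield a
  function on that segment missing from any enumeration of all such functions by \<^term>\<open>K\<close>.\<close>
lemma small_family_bounded:
  fixes K :: "'k set"
  assumes K: "sup_power_below_eq K" and N: "|N| <o |K|" and b: "\<And>j. j \<in> N \<Longrightarrow> b j \<in> K"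
    and ne: "K \<noteq> {}"
  obtains u where "u \<in> K" "\<And>j. j \<in> N \<Longrightarrow> b j = u \<or> b j \<in> underS |K| u"
proof -
  have "|Func N K| \<le>o |K|"
    by (rule card_of_Func_ordLeq[OF K N]) (simp add: card_of_mono1)
  then obtain e where e: "inj_on e (Func N K)" "e ` Func N K \<subseteq> K"
    unfolding card_of_ordLeq[symmetric] by blast
  \<comment> \<open>The values at \<open>j\<close> of all functions enumerated before place
    \<open>b j\<close>. There are fewer than \<open>|K|\<close> of them, so some element of
    \<open>K\<close> is avoided.\<close>
  define used where "used j = (\<lambda>h. h j) ` {h \<in> Func N K. e h \<in> underS |K| (b j)}" for j
  have "\<exists>z\<in>K. z \<notin> used j" if j: "j \<in> N" for j
  proof (rule ccontr)
    assume "\<not> ?thesis"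
    then have "K \<subseteq> used j" by blast
    then have "|K| \<le>o |{h \<in> Func N K. e h \<in> underS |K| (b j)}|"
      unfolding used_def by (rule surj_imp_ordLeq)
    also have "|{h \<in> Func N K. e h \<in> underS |K| (b j)}| \<le>o |underS |K| (b j)|"
      unfolding card_of_ordLeq[symmetric]
      by (rule exI[of _ e]) (auto intro: inj_on_subset[OF e(1)])
    also have "|underS |K| (b j)| <o |K|"
      by (rule card_of_underS_card_of[OF b[OF j]])
    finally show False
      using ordLess_irreflexive by blast
  qed
  then obtain f0 where f0: "\<And>j. j \<in> N \<Longrightarrow> f0 j \<in> K \<and> f0 j \<notin> used j" by metis
  define f where "f j = (if j \<in> N then f0 j else undefined)" for j
  have fF: "f \<in> Func N K"
    using f0 by (auto simp: f_def Func_def)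
  then have u: "e f \<in> K" using e by blast
  \<comment> \<open>The place of \<open>f\<close> in the enumeration is the bound: were it before
    \<open>b j\<close>, the value \<open>f j\<close> would lie in \<open>used j\<close>.\<close>
  have "b j = e f \<or> b j \<in> underS |K| (e f)" if j: "j \<in> N" for j
  proof (rule ccontr)
    assume "\<not> ?thesis"
    then have "e f \<in> underS |K| (b j)"
      using underS_card_of_total[OF u b[OF j]] by auto
    then have "f j \<in> used j"
      unfolding used_def using fF by blast
    then show False using f0[OF j] j by (simp add: f_def)
  qed
  with u that show thesis by blast
qed

text \<open>Each point is the limit of a sequence in \<open>D\<close>, and limits are unique, so
  there are at most \<open>|D|\<close> to the power aleph_0 points. Uncountability of
  \<open>K\<close> makes aleph_0 an exponent below m.\<close>

lemma card_of_metrizable_ordLeq: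
  fixes K :: "'k set"
  assumes K: "uncountable K" "sup_power_below_eq K"
    and T: "metrizable_space T" and D: "T closure_of D = topspace T" "|D| \<le>o |K|"
  shows "|topspace T| \<le>o |K|"
proof -
  obtain M d where "Metric_space M d" and TM: "T = Metric_space.mtopology M d"
    using T by (auto simp: metrizable_space_def)
  then interpret Metric_space M d by simp
  have "\<exists>s. range s \<subseteq> D \<and> limitin mtopology s x sequentially" if "x \<in> M" for x
  proof -
    have "x \<in> mtopology closure_of D"
      using D(1) that by (simp add: TM)
    then show ?thesis
      unfolding closure_of_sequentially by auto
  qed
  then obtain s where s: "\<And>x. x \<in> M \<Longrightarrow> range (s x) \<subseteq> D"
      "\<And>x. x \<in> M \<Longrightarrow> limitin mtopology (s x) x sequentially"
    by metis
  have "inj_on s M"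
    by (rule inj_onI) (metis s(2) limitin_metric_unique trivial_limit_sequentially)
  moreover have "s ` M \<subseteq> Func UNIV D"
    using s(1) by (auto simp: Func_def)
  ultimately have "|M| \<le>o |Func (UNIV :: nat set) D|"
    unfolding card_of_ordLeq[symmetric] by blast
  also have "|Func (UNIV :: nat set) D| \<le>o |K|"
    by (rule card_of_Func_ordLeq[OF K(2) nat_ordLess_uncountable[OF K(1)] D(2)])
  finally show ?thesis by (simp add: TM)
qed

lemma uncountable_infinite: "uncountable K \<Longrightarrow> infinite K"
  by (auto simp: countable_finite)

lemma countable_ordLeq_uncountable: "countable D \<Longrightarrow> uncountable K \<Longrightarrow> |D| \<le>o |K|"
  unfolding countable_iff_ordLeq_nat[of D]
  using ordLeq_transitive[OF _ ordLess_imp_ordLeq[OF nat_ordLess_uncountable]] by blast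

lemma card_of_real_ordLeq:
  fixes K :: "'k set"
  assumes "uncountable K" "sup_power_below_eq K"
  shows "|UNIV :: real set| \<le>o |K|"
proof -
  have "euclidean closure_of (\<rat> :: real set) = UNIV"
    by (simp add: Rats_closure_real)
  then show ?thesis
    using card_of_metrizable_ordLeq[OF assms metrizable_space_euclidean, of \<rat>]
      countable_ordLeq_uncountable[OF countable_rat assms(1)]
    by simp
qed

lemma weight_le_dense:
  assumes "weight_le T K"
  obtains D where "T closure_of D = topspace T" "|D| \<le>o |K|"
proof -
  obtain B where B: "\<And>U. U \<in> B \<Longrightarrow> openin T U"
      "\<And>U. openin T U \<Longrightarrow> \<exists>C\<subseteq>B. \<Union>C = U" "|B| \<le>o |K|"
    using assms unfolding weight_le_def by metis
  \<comment> \<open>One point per basic set. If the empty set is in \<open>B\<close>, its arbitrary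
    \<open>SOME\<close> value may lie outside the space, which does no harm to the closure.\<close>
  define D where "D = (\<lambda>U. SOME x. x \<in> U) ` B"
  have "x \<in> T closure_of D" if x: "x \<in> topspace T" for x
    unfolding in_closure_of
  proof (intro conjI x allI impI)
    fix U assume U: "x \<in> U \<and> openin T U"
    then obtain W where W: "W \<in> B" "x \<in> W" "W \<subseteq> U"
      using B(2) by blast
    then have "(SOME x. x \<in> W) \<in> W" by (metis someI)
    then show "\<exists>y. y \<in> D \<and> y \<in> U"
      using W by (auto simp: D_def)
  qed
  then have "T closure_of D = topspace T"
    using closure_of_subset_topspace[of T D] by blast
  moreover have "|D| \<le>o |K|"
    unfolding D_def using card_of_image B(3) ordLeq_transitive by blast
  ultimately show thesis using that by blast
qed

lemma card_of_Times_ordLeq: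
  "infinite K \<Longrightarrow> |A| \<le>o |K| \<Longrightarrow> |B| \<le>o |K| \<Longrightarrow> |A \<times> B| \<le>o |K|"
  by (rule card_of_Times_ordLeq_infinite_Field[OF _ _ _ card_of_Card_order])
    (simp_all add: Field_card_of)

lemma card_of_Plus_ordLeq:
  "infinite K \<Longrightarrow> |A| \<le>o |K| \<Longrightarrow> |B| \<le>o |K| \<Longrightarrow> |A <+> B| \<le>o |K|"
  by (rule card_of_Plus_ordLeq_infinite_Field[OF _ _ _ card_of_Card_order])
    (simp_all add: Field_card_of)

text \<open>A task is a family in \<open>Z\<close> indexed by a proper initial segment of
  \<open>K\<close>; \<open>l i\<close> names the segment and \<open>s i\<close> the family served at
  stage \<open>i\<close>. There are at most \<open>|K|\<close> tasks, so \<open>K\<close> even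
  enumerates \<open>Tasks \<times> K\<close>. Each task thus recurs too often to stay below any
  given \<open>u\<close>.\<close>

lemma cofinal_bookkeeping:
  fixes K :: "'k set" and Z :: "'z set"
  assumes K: "infinite K" "sup_power_below_eq K" and Z: "|Z| \<le>o |K|" "Z \<noteq> {}"
  obtains l :: "'k \<Rightarrow> 'k" and s :: "'k \<Rightarrow> 'k \<Rightarrow> 'z"
  where "\<forall>m\<in>K. \<forall>u\<in>K. \<forall>t. (\<forall>j\<in>underS |K| m. t j \<in> Z) \<longrightarrow>
      (\<exists>i\<in>K. u \<in> underS |K| i \<and> l i = m \<and> (\<forall>j\<in>underS |K| m. s i j = t j))"
proof -
  define Tasks where "Tasks = (SIGMA m:K. Func (underS |K| m) Z)"
  have "|Tasks| \<le>o |K|"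
    unfolding Tasks_def
  proof (rule card_of_Sigma_ordLeq_infinite[OF K(1)])
    show "|K| \<le>o |K|" by (rule card_of_mono1) simp
    show "\<forall>m\<in>K. |Func (underS |K| m) Z| \<le>o |K|"
      using card_of_Func_ordLeq[OF K(2) card_of_underS_card_of Z(1)] by blast
  qed
  then have "|Tasks \<times> K| \<le>o |K|"
    by (rule card_of_Times_ordLeq[OF K(1)]) (rule card_of_mono1[OF order.refl])
  moreover have "Tasks \<times> K \<noteq> {}"
  proof -
    obtain m z where "m \<in> K" "z \<in> Z" using infinite_imp_nonempty[OF K(1)] Z(2) by blast
    then have "((m, \<lambda>j. if j \<in> underS |K| m then z else undefined), m) \<in> Tasks \<times> K"
      by (simp add: Tasks_def Func_def)
    then show ?thesis by blast
  qed
  ultimately have "\<exists>\<sigma>. \<sigma> ` K = Tasks \<times> K"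
    by (simp add: card_of_ordLeq2)
  then obtain \<sigma> where \<sigma>: "\<sigma> ` K = Tasks \<times> K" by (elim exE)
  show thesis
  proof (rule that, intro ballI allI impI)
    fix m u and t :: "'k \<Rightarrow> 'z"
    assume m: "m \<in> K" and u: "u \<in> K" and t: "\<forall>j\<in>underS |K| m. t j \<in> Z"
    define t' where "t' j = (if j \<in> underS |K| m then t j else undefined)" for j
    have t': "(m, t') \<in> Tasks"
      using m t by (auto simp: Tasks_def Func_def t'_def)
    have "\<exists>i\<in>K. u \<in> underS |K| i \<and> fst (\<sigma> i) = (m, t')"
    proof (rule ccontr)
      assume "\<not> ?thesis"
      then have *: "i \<in> insert u (underS |K| u)" if "i \<in> K" "fst (\<sigma> i) = (m, t')" for i
        using that underS_card_of_total[OF u that(1)] by auto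
      \<comment> \<open>All stages serving the task would lie in a closed segment of size below
        \<open>|K|\<close>, yet their second components exhaust \<open>K\<close>.\<close>
      have "K \<subseteq> (\<lambda>i. snd (\<sigma> i)) ` ({u} \<union> underS |K| u)"
      proof
        fix v assume "v \<in> K"
        then have "((m, t'), v) \<in> \<sigma> ` K" using \<sigma> t' by simp
        then obtain i where "i \<in> K" "\<sigma> i = ((m, t'), v)" by auto
        then show "v \<in> (\<lambda>i. snd (\<sigma> i)) ` ({u} \<union> underS |K| u)"
          using *[of i] by (intro image_eqI[of _ _ i]) simp_all
      qed
      then have "|K| \<le>o |{u} \<union> underS |K| u|"
        by (rule surj_imp_ordLeq)
      also have "|{u} \<union> underS |K| u| <o |K|"
      proof (rule card_of_Un_ordLess_infinite[OF K(1) _ card_of_underS_card_of[OF u]])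
        show "|{u}| <o |K|"
          by (rule finite_ordLess_infinite[OF card_of_Well_order card_of_Well_order])
            (simp_all add: Field_card_of K(1))
      qed
      finally show False
        using ordLess_irreflexive by blast
    qed
    then obtain i where "i \<in> K" "u \<in> underS |K| i" "fst (\<sigma> i) = (m, t')" by blast
    then show "\<exists>i\<in>K. u \<in> underS |K| i \<and> fst (fst (\<sigma> i)) = m \<and>
        (\<forall>j\<in>underS |K| m. snd (fst (\<sigma> i)) j = t j)"
      by (intro bexI[of _ i]) (simp_all add: t'_def)
  qed
qed

section \<open>Conjugation-invariant norms\<close>

text \<open>The pivot \<open>x\<close> is the first entry whose tail weighs less than
  \<open>b\<close>. If anything precedes it, then \<open>x # zs\<close> weighs at least
  \<open>b\<close>, which leaves less than \<open>a\<close> for \<open>ys\<close>.\<close>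

lemma sum_list_split:
  fixes w :: "'a \<Rightarrow> real"
  assumes "xs \<noteq> []" "sum_list (map w xs) < a + b" "0 < a" "0 < b" "\<And>x. 0 \<le> w x"
  obtains ys x zs where "xs = ys @ x # zs" "sum_list (map w ys) < a" "sum_list (map w zs) < b"
proof -
  have "\<exists>ys x zs. xs = ys @ x # zs \<and> sum_list (map w ys) < a \<and> sum_list (map w zs) < b"
    using assms(1-3)
  proof (induction xs arbitrary: a)
    case (Cons x xs)
    show ?case
    proof (cases "sum_list (map w xs) < b")
      case True
      with Cons.prems show ?thesis
        by (intro exI[of _ "[]"]) auto
    next
      case False
      then have "xs \<noteq> []" using assms(4) by auto
      moreover have "sum_list (map w xs) < (a - w x) + b" "0 < a - w x"
        using Cons.prems False by auto
      ultimately obtain ys y zs where "xs = ys @ y # zs" "sum_list (map w ys) < a - w x"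
          "sum_list (map w zs) < b"
        using Cons.IH[of "a - w x"] by blast
      then show ?thesis
        by (intro exI[of _ "x # ys"]) auto
    qed
  qed simp
  then show thesis using that by blast
qed

definition conj_invariant_norm :: "('g, 'b) monoid_scheme \<Rightarrow> ('g \<Rightarrow> real) \<Rightarrow> bool" where
  "conj_invariant_norm G N \<longleftrightarrow>
     (\<forall>x\<in>carrier G. 0 \<le> N x \<and> (N x = 0 \<longleftrightarrow> x = \<one>\<^bsub>G\<^esub>) \<and> N (inv\<^bsub>G\<^esub> x) = N x \<and>
        (\<forall>y\<in>carrier G. N (x \<otimes>\<^bsub>G\<^esub> y) \<le> N x + N y \<and> N (x \<otimes>\<^bsub>G\<^esub> y \<otimes>\<^bsub>G\<^esub> inv\<^bsub>G\<^esub> x) = N y))"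

context group
begin

lemma inv_cancel_left:
  assumes "x \<in> carrier G" "y \<in> carrier G"
  shows "inv x \<otimes> (x \<otimes> y) = y" "x \<otimes> (inv x \<otimes> y) = y"
  using assms by (simp_all flip: m_assoc)

lemmas word_simps = m_assoc inv_mult_group inv_cancel_left

definition list_prod :: "'a list \<Rightarrow> 'a" where
  "list_prod xs = foldr (\<otimes>) xs \<one>"

lemma list_prod_simps [simp]: "list_prod [] = \<one>" "list_prod (x # xs) = x \<otimes> list_prod xs"
  by (simp_all add: list_prod_def)

lemma list_prod_closed [simp]: "set xs \<subseteq> carrier G \<Longrightarrow> list_prod xs \<in> carrier G"
  by (induction xs) auto

lemma list_prod_append:
  "set xs \<subseteq> carrier G \<Longrightarrow> set ys \<subseteq> carrier G \<Longrightarrow> list_prod (xs @ ys) = list_prod xs \<otimes> list_prod ys"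
  by (induction xs) (auto simp: m_assoc)

lemma list_prod_inv:
  "set xs \<subseteq> carrier G \<Longrightarrow> list_prod (rev (map (m_inv G) xs)) = inv (list_prod xs)"
proof (induction xs)
  case (Cons x xs)
  then have "set (rev (map (m_inv G) xs)) \<subseteq> carrier G" by auto
  with Cons show ?case
    using list_prod_append[of "rev (map (m_inv G) xs)" "[inv x]"] by (simp add: inv_mult_group)
qed simp

lemma list_prod_conj:
  assumes "g \<in> carrier G"
  shows "set xs \<subseteq> carrier G \<Longrightarrow>
    list_prod (map (\<lambda>x. g \<otimes> x \<otimes> inv g) xs) = g \<otimes> list_prod xs \<otimes> inv g"
proof (induction xs)
  case (Cons x xs)
  then have x: "x \<in> carrier G" "list_prod xs \<in> carrier G" by auto
  then show ?case
    using Cons x assms by (simp add: word_simps)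
qed (use assms in simp)

text \<open>\<open>w\<close> is the dyadic size read off the chain, and \<open>N x\<close> the
  infimum of the total size over all factorisations of \<open>x\<close>, which forces subadditivity.
  Inverting or conjugating a factorisation keeps its size, whence the invariance. By
  \<open>chain\<close>, passing to the infimum does not collapse the norm.\<close>

lemma chain_norm:
  assumes U0: "U 0 = carrier G" and one: "\<And>n. \<one> \<in> U n"
    and triple: "\<And>n x y z. x \<in> U (Suc n) \<Longrightarrow> y \<in> U (Suc n) \<Longrightarrow> z \<in> U (Suc n) \<Longrightarrow> x \<otimes> y \<otimes> z \<in> U n"
    and sub: "\<And>n. U n \<subseteq> carrier G"
    and sym: "\<And>n x. x \<in> U n \<Longrightarrow> inv x \<in> U n"
    and conj: "\<And>n g x. g \<in> carrier G \<Longrightarrow> x \<in> U n \<Longrightarrow> g \<otimes> x \<otimes> inv g \<in> U n"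
    and sep: "\<And>x. (\<And>n. x \<in> U n) \<Longrightarrow> x = \<one>"
  obtains N where "conj_invariant_norm G N"
    "\<forall>n. \<forall>x\<in>U n. N x \<le> (1/2)^n" "\<forall>n. \<forall>x\<in>carrier G. N x < (1/2)^n \<longrightarrow> x \<in> U n"
proof -
  have Usuc: "U (Suc n) \<subseteq> U n" for n
  proof
    fix x assume "x \<in> U (Suc n)"
    with triple[OF this one one] sub[of "Suc n"] show "x \<in> U n" by (auto simp: subset_iff)
  qed
  have mono: "U n \<subseteq> U m" if "m \<le> n" for m n
    using lift_Suc_antimono_le[of U m n, OF Usuc that] .
  define W :: "'a \<Rightarrow> real set" where "W x = {(1/2)^n | n. x \<in> U n}" for x
  \<comment> \<open>The value 0 for an empty \<open>W x\<close>, possible only outside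
    \<open>carrier G\<close>, makes \<open>w\<close> nonnegative everywhere.\<close>
  define w where "w x = (if W x = {} then 0 else Inf (W x))" for x
  have bdd: "bdd_below (W x)" for x
    by (rule bdd_belowI[of _ 0]) (auto simp: W_def)
  have w0: "0 \<le> w x" for x
    by (auto simp: w_def W_def intro!: cInf_greatest)
  have wle: "w x \<le> (1/2)^n" if "x \<in> U n" for x n
  proof -
    have "(1/2)^n \<in> W x" using that by (auto simp: W_def)
    then show ?thesis using cInf_lower[OF _ bdd] by (auto simp: w_def)
  qed
  \<comment> \<open>One index is gained: a power of 1/2 smaller than \<open>(1/2)^n\<close> is at
    most \<open>(1/2)^Suc n\<close>. This is what puts the pivot of a list into
    \<open>U (Suc n)\<close>.\<close>
  have wlt: "x \<in> U (Suc n)" if "x \<in> carrier G" "w x < (1/2)^n" for x n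
  proof -
    have ne: "W x \<noteq> {}" using that U0 by (auto simp: W_def)
    with that(2) have "Inf (W x) < (1/2)^n" by (simp add: w_def)
    then obtain a where "a \<in> W x" "a < (1/2)^n"
      using cInf_lessD[OF ne] by blast
    then obtain m where m: "x \<in> U m" "(1/2::real)^m < (1/2)^n"
      by (auto simp: W_def)
    have "Suc n \<le> m"
    proof (rule ccontr)
      assume "\<not> ?thesis"
      then have "(1/2::real)^n \<le> (1/2)^m" by (intro power_decreasing) auto
      with m(2) show False by simp
    qed
    then show ?thesis using mono m(1) by blast
  qed
  have Winv: "w (inv x) = w x" if "x \<in> carrier G" for x
  proof -
    have "inv x \<in> U n \<longleftrightarrow> x \<in> U n" for n
      using sym[of x n] sym[of "inv x" n] that by auto
    then show ?thesis by (simp add: w_def W_def)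
  qed
  have Wconj: "w (g \<otimes> x \<otimes> inv g) = w x" if "g \<in> carrier G" "x \<in> carrier G" for g x
  proof -
    have "inv g \<otimes> (g \<otimes> x \<otimes> inv g) \<otimes> inv (inv g) = x"
      using that by (simp add: word_simps)
    then have "g \<otimes> x \<otimes> inv g \<in> U n \<longleftrightarrow> x \<in> U n" for n
      using conj[of g x n] conj[of "inv g" "g \<otimes> x \<otimes> inv g" n] that by auto
    then show ?thesis by (simp add: w_def W_def)
  qed
  \<comment> \<open>Induction on length: a pivot splits the list into two parts of size below
    \<open>(1/2)^Suc n\<close>, so all three factors lie in \<open>U (Suc n)\<close> and
    \<open>triple\<close> applies.\<close>
  have chain: "set xs \<subseteq> carrier G \<Longrightarrow> sum_list (map w xs) < (1/2)^n \<Longrightarrow> list_prod xs \<in> U n" for xs n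
  proof (induction xs arbitrary: n rule: length_induct)
    case (1 xs)
    show ?case
    proof (cases "xs = []")
      case True
      then show ?thesis using one by simp
    next
      case False
      obtain ys x zs where s: "xs = ys @ x # zs" "sum_list (map w ys) < (1/2)^Suc n"
          "sum_list (map w zs) < (1/2)^Suc n"
        by (rule sum_list_split[OF False, of w "(1/2)^Suc n" "(1/2)^Suc n"])
          (use "1.prems" w0 in auto)
      have "list_prod ys \<in> U (Suc n)" "list_prod zs \<in> U (Suc n)"
        using "1.IH" "1.prems" s by auto
      moreover have "x \<in> U (Suc n)"
      proof (rule wlt)
        have "0 \<le> sum_list (map w ys)" "0 \<le> sum_list (map w zs)"
          by (auto intro!: sum_list_nonneg w0)
        then show "w x < (1/2)^n" using "1.prems" s(1) by simp
      qed (use "1.prems" s in auto)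
      ultimately have "list_prod ys \<otimes> x \<otimes> list_prod zs \<in> U n"
        using triple by blast
      then show ?thesis
        using "1.prems" s(1) by (simp add: list_prod_append m_assoc)
    qed
  qed
  define C where "C x = {xs. set xs \<subseteq> carrier G \<and> list_prod xs = x}" for x
  define N where "N x = (INF xs\<in>C x. sum_list (map w xs))" for x
  have bddN: "bdd_below ((\<lambda>xs. sum_list (map w xs)) ` A)" for A
    by (rule bdd_belowI[of _ 0]) (auto intro!: sum_list_nonneg w0)
  have Cself: "[x] \<in> C x" if "x \<in> carrier G" for x
    using that by (simp add: C_def)
  have N0: "0 \<le> N x" if "x \<in> carrier G" for x
    unfolding N_def by (rule cINF_greatest) (use Cself[OF that] in \<open>auto intro!: sum_list_nonneg w0\<close>)
  have Nle: "N x \<le> sum_list (map w xs)" if "set xs \<subseteq> carrier G" "list_prod xs = x" for x xs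
    unfolding N_def by (rule cINF_lower[OF bddN]) (use that in \<open>simp add: C_def\<close>)
  have Napprox: "\<exists>xs. set xs \<subseteq> carrier G \<and> list_prod xs = x \<and> sum_list (map w xs) < e"
    if "x \<in> carrier G" "N x < e" for x e
  proof -
    have "C x \<noteq> {}" using Cself[OF that(1)] by blast
    then have "\<exists>xs\<in>C x. sum_list (map w xs) < e"
      using that(2) cINF_less_iff[OF _ bddN, of "C x" e] by (simp add: N_def)
    then show ?thesis by (auto simp: C_def)
  qed
  have NU: "N x \<le> (1/2)^n" if "x \<in> U n" for x n
    using Nle[of "[x]" x] wle[OF that] sub[of n] that by auto
  have UN: "x \<in> U n" if "x \<in> carrier G" "N x < (1/2)^n" for x n
    using Napprox[OF that] chain by blast
  have Nadd: "N (x \<otimes> y) \<le> N x + N y" if t: "x \<in> carrier G" "y \<in> carrier G" for x y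
  proof (rule field_le_epsilon)
    fix e :: real assume "0 < e"
    then obtain xs ys where "set xs \<subseteq> carrier G" "list_prod xs = x" "sum_list (map w xs) < N x + e/2"
        "set ys \<subseteq> carrier G" "list_prod ys = y" "sum_list (map w ys) < N y + e/2"
      using Napprox[OF t(1), of "N x + e/2"] Napprox[OF t(2), of "N y + e/2"] by auto
    then show "N (x \<otimes> y) \<le> N x + N y + e"
      using Nle[of "xs @ ys" "x \<otimes> y"] by (simp add: list_prod_append)
  qed
  have Ninv_le: "N (inv x) \<le> N x" if t: "x \<in> carrier G" for x
  proof (rule field_le_epsilon)
    fix e :: real assume "0 < e"
    then obtain xs where xs: "set xs \<subseteq> carrier G" "list_prod xs = x" "sum_list (map w xs) < N x + e"
      using Napprox[OF t, of "N x + e"] by auto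
    have "set (rev (map (m_inv G) xs)) \<subseteq> carrier G" using xs(1) by auto
    from Nle[OF this list_prod_inv[OF xs(1)]]
    have "N (inv x) \<le> sum_list (map w (rev (map (m_inv G) xs)))" by (simp add: xs(2))
    also have "sum_list (map w (rev (map (m_inv G) xs))) = sum_list (map w xs)"
      using xs(1) by (induction xs) (auto simp: Winv)
    finally show "N (inv x) \<le> N x + e" using xs(3) by simp
  qed
  have Nconj_le: "N (g \<otimes> x \<otimes> inv g) \<le> N x" if t: "g \<in> carrier G" "x \<in> carrier G" for g x
  proof (rule field_le_epsilon)
    fix e :: real assume "0 < e"
    then obtain xs where xs: "set xs \<subseteq> carrier G" "list_prod xs = x" "sum_list (map w xs) < N x + e"
      using Napprox[OF t(2), of "N x + e"] by auto
    have "set (map (\<lambda>x. g \<otimes> x \<otimes> inv g) xs) \<subseteq> carrier G" using xs(1) t(1) by auto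
    from Nle[OF this list_prod_conj[OF t(1) xs(1)]]
    have "N (g \<otimes> x \<otimes> inv g) \<le> sum_list (map w (map (\<lambda>x. g \<otimes> x \<otimes> inv g) xs))"
      by (simp add: xs(2))
    also have "sum_list (map w (map (\<lambda>x. g \<otimes> x \<otimes> inv g) xs)) = sum_list (map w xs)"
      using xs(1) by (induction xs) (auto simp: Wconj that)
    finally show "N (g \<otimes> x \<otimes> inv g) \<le> N x + e" using xs(3) by simp
  qed
  have Ninv: "N (inv x) = N x" if "x \<in> carrier G" for x
    using Ninv_le[OF that] Ninv_le[of "inv x"] that by simp
  have Nconj: "N (g \<otimes> x \<otimes> inv g) = N x" if "g \<in> carrier G" "x \<in> carrier G" for g x
  proof -
    have "inv g \<otimes> (g \<otimes> x \<otimes> inv g) \<otimes> inv (inv g) = x"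
      using that by (simp add: word_simps)
    then show ?thesis
      using Nconj_le[OF that] Nconj_le[of "inv g" "g \<otimes> x \<otimes> inv g"] that by simp
  qed
  have "N x = 0 \<longleftrightarrow> x = \<one>" if "x \<in> carrier G" for x
  proof
    assume "N x = 0"
    then have "x \<in> U n" for n using UN[OF that, of n] by simp
    then show "x = \<one>" by (rule sep)
  next
    assume "x = \<one>"
    then show "N x = 0" using Nle[of "[]" \<one>] N0[of \<one>] by simp
  qed
  then have "conj_invariant_norm G N"
    using N0 Nadd Ninv Nconj by (simp add: conj_invariant_norm_def)
  then show thesis using that NU UN by blast
qed

end

context group
begin

text \<open>The left-invariant metric of the norm. The value 0 off the carrier is there because
  \<open>Metric_space\<close> demands nonnegativity and symmetry for all arguments.\<close>

lemma Metric_space_norm: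
  assumes N: "conj_invariant_norm G N"
  shows "Metric_space (carrier G) (\<lambda>x y. if x \<in> carrier G \<and> y \<in> carrier G then N (inv x \<otimes> y) else 0)"
proof
  fix x y z
  show "(if x \<in> carrier G \<and> y \<in> carrier G then N (inv x \<otimes> y) else 0) =
      (if y \<in> carrier G \<and> x \<in> carrier G then N (inv y \<otimes> x) else 0)"
  proof (cases "x \<in> carrier G \<and> y \<in> carrier G")
    case True
    then have "N (inv (inv x \<otimes> y)) = N (inv x \<otimes> y)"
      using N by (simp add: conj_invariant_norm_def)
    then show ?thesis using True by (simp add: inv_mult_group)
  qed auto
  assume x: "x \<in> carrier G" and y: "y \<in> carrier G"
  show "((if x \<in> carrier G \<and> y \<in> carrier G then N (inv x \<otimes> y) else 0) = 0) = (x = y)"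
  proof -
    have "N (inv x \<otimes> y) = 0 \<longleftrightarrow> inv x \<otimes> y = \<one>"
      using N x y by (simp add: conj_invariant_norm_def)
    also have "\<dots> \<longleftrightarrow> x = y"
      using x y inv_cancel_left(2)[OF x y] by auto
    finally show ?thesis using x y by simp
  qed
  assume z: "z \<in> carrier G"
  have "inv x \<otimes> z = (inv x \<otimes> y) \<otimes> (inv y \<otimes> z)"
    using x y z by (simp add: word_simps)
  then show "(if x \<in> carrier G \<and> z \<in> carrier G then N (inv x \<otimes> z) else 0)
      \<le> (if x \<in> carrier G \<and> y \<in> carrier G then N (inv x \<otimes> y) else 0) +
        (if y \<in> carrier G \<and> z \<in> carrier G then N (inv y \<otimes> z) else 0)"
    using N x y z by (simp add: conj_invariant_norm_def)
qed (use N in \<open>auto simp: conj_invariant_norm_def\<close>)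

end

section \<open>Compatible conjugation-invariant norms on metrizable SIN groups\<close>

context
  fixes G :: "('g, 'b) monoid_scheme" (structure) and T :: "'g topology"
  assumes tg: "topological_group G T"
begin

interpretation group G
  using tg by (simp add: topological_group_def)

lemma tg_topspace: "topspace T = carrier G"
  using tg by (simp add: topological_group_def)

lemma tg_mult: "continuous_map (prod_topology T T) T (\<lambda>(x, y). x \<otimes> y)"
  using tg by (simp add: topological_group_def)

lemma tg_inv: "continuous_map T T (m_inv G)"
  using tg by (simp add: topological_group_def)

lemma tg_triple_nbhd:
  assumes U: "openin T U" "\<one> \<in> U"
  obtains V where "openin T V" "\<one> \<in> V" "\<forall>x\<in>V. \<forall>y\<in>V. \<forall>z\<in>V. x \<otimes> y \<otimes> z \<in> U"
proof -
  have *: "\<exists>V. openin T V \<and> \<one> \<in> V \<and> (\<forall>x\<in>V. \<forall>y\<in>V. x \<otimes> y \<in> U)"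
    if U: "openin T U" "\<one> \<in> U" for U
  proof -
    have "openin (prod_topology T T) {p \<in> topspace (prod_topology T T). (\<lambda>(x, y). x \<otimes> y) p \<in> U}"
      by (rule openin_continuous_map_preimage[OF tg_mult U(1)])
    moreover have "(\<one>, \<one>) \<in> {p \<in> topspace (prod_topology T T). (\<lambda>(x, y). x \<otimes> y) p \<in> U}"
      using U(2) by (simp add: tg_topspace)
    ultimately have "\<exists>A B. openin T A \<and> openin T B \<and> \<one> \<in> A \<and> \<one> \<in> B \<and>
        A \<times> B \<subseteq> {p \<in> topspace (prod_topology T T). (\<lambda>(x, y). x \<otimes> y) p \<in> U}"
      by (simp only: openin_prod_topology_alt)
    then obtain A B where AB: "openin T A" "openin T B" "\<one> \<in> A" "\<one> \<in> B"
        "A \<times> B \<subseteq> {p \<in> topspace (prod_topology T T). (\<lambda>(x, y). x \<otimes> y) p \<in> U}"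
      by (elim exE conjE)
    then show ?thesis
      by (intro exI[of _ "A \<inter> B"]) auto
  qed
  obtain V where V: "openin T V" "\<one> \<in> V" "\<forall>x\<in>V. \<forall>y\<in>V. x \<otimes> y \<in> U"
    using *[OF U] by blast
  obtain W where W: "openin T W" "\<one> \<in> W" "\<forall>x\<in>W. \<forall>y\<in>W. x \<otimes> y \<in> V"
    using *[OF V(1,2)] by blast
  have "W \<subseteq> carrier G" using openin_subset[OF W(1)] tg_topspace by simp
  then have "W \<subseteq> V" using W(2,3) by (metis l_one subset_iff)
  then show thesis using that[OF W(1,2)] V(3) W(3) by blast
qed

lemma tg_left_translation_nbhd:
  assumes U: "openin T U" and g: "g \<in> carrier G"
  shows "openin T {x \<in> carrier G. g \<otimes> x \<in> U}"
proof -
  have "continuous_map T (prod_topology T T) (\<lambda>x. (g, x))"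
    by (intro continuous_map_pairedI) (simp_all add: g tg_topspace)
  then have "continuous_map T T ((\<lambda>(x, y). x \<otimes> y) \<circ> (\<lambda>x. (g, x)))"
    by (rule continuous_map_compose[OF _ tg_mult])
  then have "continuous_map T T (\<lambda>x. g \<otimes> x)" by (simp add: comp_def)
  from openin_continuous_map_preimage[OF this U] show ?thesis
    by (simp add: tg_topspace)
qed

text \<open>An invariant neighbourhood \<open>V0\<close> inside \<open>O1\<close> is intersected
  with its image under inversion; inversion commutes with conjugation, so invariance survives.
  \<open>V\<close> need not be open, hence the formulation through its interior.\<close>

lemma SIN_nbhd:
  assumes SIN: "SIN G T" and U: "openin T U" "\<one> \<in> U"
  obtains V where "V \<subseteq> U" "\<one> \<in> T interior_of V" "\<forall>x\<in>V. inv x \<in> V"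
    "\<forall>g\<in>carrier G. \<forall>x\<in>V. g \<otimes> x \<otimes> inv g \<in> V"
    "\<forall>x\<in>V. \<forall>y\<in>V. \<forall>z\<in>V. x \<otimes> y \<otimes> z \<in> U"
proof -
  obtain O1 where O1: "openin T O1" "\<one> \<in> O1"
      "\<forall>x\<in>O1. \<forall>y\<in>O1. \<forall>z\<in>O1. x \<otimes> y \<otimes> z \<in> U"
    by (rule tg_triple_nbhd[OF U])
  have O1c: "O1 \<subseteq> carrier G" using openin_subset[OF O1(1)] tg_topspace by simp
  obtain V0 where V0: "V0 \<subseteq> O1" "\<one> \<in> T interior_of V0"
      "\<forall>g\<in>carrier G. \<forall>x\<in>V0. g \<otimes> x \<otimes> inv g \<in> V0"
    using SIN O1(1,2) unfolding SIN_def by meson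
  define V where "V = {x \<in> V0. inv x \<in> V0}"
  have Vc: "V \<subseteq> carrier G" "V \<subseteq> O1" using V0(1) O1c by (auto simp: V_def)
  show thesis
  proof (rule that)
    show "V \<subseteq> U"
    proof
      fix x assume "x \<in> V"
      then have "x \<otimes> \<one> \<otimes> \<one> \<in> U" using O1(2,3) Vc by blast
      then show "x \<in> U" using \<open>x \<in> V\<close> Vc by (auto simp: subset_iff)
    qed
    show "\<one> \<in> T interior_of V"
    proof -
      have "openin T {x \<in> topspace T. inv x \<in> T interior_of V0}"
        by (rule openin_continuous_map_preimage[OF tg_inv]) simp
      then have "openin T ({x \<in> topspace T. inv x \<in> T interior_of V0} \<inter> T interior_of V0)"
        by (rule openin_Int) simp
      moreover have "{x \<in> topspace T. inv x \<in> T interior_of V0} \<inter> T interior_of V0 \<subseteq> V"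
        using interior_of_subset[of T V0] by (auto simp: V_def)
      ultimately have "{x \<in> topspace T. inv x \<in> T interior_of V0} \<inter> T interior_of V0 \<subseteq> T interior_of V"
        by (rule interior_of_maximal[rotated])
      then show ?thesis using V0(2) by (auto simp: tg_topspace)
    qed
    show "\<forall>x\<in>V. inv x \<in> V"
    proof
      fix x assume "x \<in> V"
      moreover from this have "inv (inv x) = x" using Vc by auto
      ultimately show "inv x \<in> V" by (simp add: V_def)
    qed
    show "\<forall>g\<in>carrier G. \<forall>x\<in>V. g \<otimes> x \<otimes> inv g \<in> V"
    proof (intro ballI)
      fix g x assume that: "g \<in> carrier G" "x \<in> V"
      have x: "x \<in> carrier G" using that Vc by auto
      have "inv (g \<otimes> x \<otimes> inv g) = g \<otimes> inv x \<otimes> inv g"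
        using that x by (simp add: inv_mult_group m_assoc)
      then show "g \<otimes> x \<otimes> inv g \<in> V" using that V0(3) by (simp add: V_def)
    qed
    show "\<forall>x\<in>V. \<forall>y\<in>V. \<forall>z\<in>V. x \<otimes> y \<otimes> z \<in> U"
      using O1(3) Vc(2) by blast
  qed
qed

text \<open>A chain for \<open>chain_norm\<close> is chosen recursively by \<open>SIN_nbhd\<close>,
  each new member also confined to a small ball of the given metric, so that the chain is a
  neighbourhood base at the identity. Left translation carries the comparison of the two topologies
  from the identity to every point.\<close>

lemma SIN_norm:
  assumes SIN: "SIN G T" and metr: "metrizable_space T"
  obtains N where "conj_invariant_norm G N"
    "T = Metric_space.mtopology (carrier G)
      (\<lambda>x y. if x \<in> carrier G \<and> y \<in> carrier G then N (inv x \<otimes> y) else 0)"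
proof -
  obtain M m where "Metric_space M m" and TM: "T = Metric_space.mtopology M m"
    using metr by (auto simp: metrizable_space_def)
  then interpret M: Metric_space M m by simp
  have MG: "M = carrier G" using tg_topspace TM by simp
  define P where "P n V \<longleftrightarrow> \<one> \<in> T interior_of V \<and> V \<subseteq> carrier G \<and> (\<forall>x\<in>V. inv x \<in> V) \<and>
      (\<forall>g\<in>carrier G. \<forall>x\<in>V. g \<otimes> x \<otimes> inv g \<in> V) \<and> (n = 0 \<longrightarrow> V = carrier G)"
    for n :: nat and V
  define Q where "Q n V W \<longleftrightarrow> (\<forall>x\<in>W. \<forall>y\<in>W. \<forall>z\<in>W. x \<otimes> y \<otimes> z \<in> V) \<and>
      W \<subseteq> M.mball \<one> (inverse (Suc n))" for n V W
  have "\<exists>U. \<forall>n. P n (U n) \<and> Q n (U n) (U (Suc n))"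
  proof (rule dependent_nat_choice)
    have "T interior_of carrier G = carrier G"
      using interior_of_topspace[of T] by (simp add: tg_topspace)
    then show "\<exists>V. P 0 V"
      by (intro exI[of _ "carrier G"]) (simp add: P_def)
  next
    fix V n assume V: "P n V"
    let ?O = "T interior_of V \<inter> M.mball \<one> (inverse (Suc n))"
    have O1: "openin T ?O" by (rule openin_Int) (simp_all add: TM)
    have "\<one> \<in> M" by (simp add: MG)
    then have "\<one> \<in> M.mball \<one> (inverse (Suc n))" by simp
    then have O2: "\<one> \<in> ?O" using V unfolding P_def by blast
    obtain W where W: "W \<subseteq> ?O" "\<one> \<in> T interior_of W" "\<forall>x\<in>W. inv x \<in> W"
        "\<forall>g\<in>carrier G. \<forall>x\<in>W. g \<otimes> x \<otimes> inv g \<in> W"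
        "\<forall>x\<in>W. \<forall>y\<in>W. \<forall>z\<in>W. x \<otimes> y \<otimes> z \<in> ?O"
      by (rule SIN_nbhd[OF SIN O1 O2])
    have OV: "?O \<subseteq> V" and OM: "?O \<subseteq> M.mball \<one> (inverse (Suc n))"
      using interior_of_subset[of T V] by auto
    have "V \<subseteq> carrier G" using V by (simp add: P_def)
    then have "W \<subseteq> carrier G" using W(1) OV by (meson order.trans)
    then have "P (Suc n) W"
      using W(2-4) by (simp add: P_def)
    moreover have "Q n V W"
      unfolding Q_def using W(5) OV order.trans[OF W(1) OM] by (meson subsetD)
    ultimately show "\<exists>W. P (Suc n) W \<and> Q n V W" by blast
  qed
  then obtain U where U: "\<And>n. P n (U n)" "\<And>n. Q n (U n) (U (Suc n))" by blast
  have one: "\<one> \<in> U n" for n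
    using U(1)[of n] interior_of_subset[of T "U n"] by (auto simp: P_def)
  have sep: "x = \<one>" if "\<And>n. x \<in> U n" for x
  proof (rule ccontr)
    assume "x \<noteq> \<one>"
    have "x \<in> M" using that[of 0] U(1)[of 0] by (simp add: P_def MG)
    then have "0 < m \<one> x" using \<open>x \<noteq> \<one>\<close> by (simp add: MG)
    then obtain n where "inverse (real (Suc n)) < m \<one> x"
      using reals_Archimedean by blast
    moreover have "x \<in> M.mball \<one> (inverse (Suc n))"
      using that[of "Suc n"] U(2)[of n] by (auto simp: Q_def)
    ultimately show False by simp
  qed
  have U3: "x \<otimes> y \<otimes> z \<in> U n" if "x \<in> U (Suc n)" "y \<in> U (Suc n)" "z \<in> U (Suc n)" for n x y z
    using U(2)[of n] that by (simp add: Q_def)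
  have Uc: "U n \<subseteq> carrier G" and Ui: "\<And>x. x \<in> U n \<Longrightarrow> inv x \<in> U n"
    and Ug: "\<And>g x. g \<in> carrier G \<Longrightarrow> x \<in> U n \<Longrightarrow> g \<otimes> x \<otimes> inv g \<in> U n" for n
    using U(1)[of n] by (simp_all add: P_def)
  have U0: "U 0 = carrier G" using U(1)[of 0] by (simp add: P_def)
  obtain N where N: "conj_invariant_norm G N" "\<forall>n. \<forall>x\<in>U n. N x \<le> (1/2)^n"
      "\<forall>n. \<forall>x\<in>carrier G. N x < (1/2)^n \<longrightarrow> x \<in> U n"
    by (rule chain_norm[where U = U, OF U0 one U3 Uc Ui Ug sep])
  let ?d = "\<lambda>x y. if x \<in> carrier G \<and> y \<in> carrier G then N (inv x \<otimes> y) else 0"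
  interpret D: Metric_space "carrier G" ?d
    by (rule Metric_space_norm[OF N(1)])
  have "openin T S \<longleftrightarrow> openin D.mtopology S" for S
  proof
    assume S: "openin T S"
    show "openin D.mtopology S"
      unfolding D.openin_mtopology
    proof (intro conjI allI impI)
      show Sc: "S \<subseteq> carrier G" using openin_subset[OF S] tg_topspace by simp
      fix x assume x: "x \<in> S"
      then have xc: "x \<in> carrier G" using Sc by blast
      have "openin T {y \<in> carrier G. x \<otimes> y \<in> S}" by (rule tg_left_translation_nbhd[OF S xc])
      moreover have "\<one> \<in> {y \<in> carrier G. x \<otimes> y \<in> S}" using x xc by simp
      ultimately obtain r where r: "r > 0" "M.mball \<one> r \<subseteq> {y \<in> carrier G. x \<otimes> y \<in> S}"
        unfolding TM M.openin_mtopology by blast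
      obtain n where n: "inverse (real (Suc n)) < r" using reals_Archimedean[OF r(1)] by blast
      \<comment> \<open>\<open>N\<close> below \<open>(1/2)^Suc n\<close> gives membership in
        \<open>U (Suc n)\<close>, which \<open>Q\<close> puts into the ball of radius
        \<open>inverse (Suc n)\<close> and hence into the translate of \<open>S\<close>.\<close>
      have "D.mball x ((1/2)^Suc n) \<subseteq> S"
      proof
        fix y assume "y \<in> D.mball x ((1/2)^Suc n)"
        then have y: "y \<in> carrier G" "N (inv x \<otimes> y) < (1/2)^Suc n" using xc by auto
        then have "inv x \<otimes> y \<in> U (Suc n)" using N(3) inv_closed[OF xc] m_closed by blast
        then have "inv x \<otimes> y \<in> M.mball \<one> r"
          using U(2)[of n] M.mball_subset_concentric[of "inverse (Suc n)" r \<one>] n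
          unfolding Q_def by auto
        then have "x \<otimes> (inv x \<otimes> y) \<in> S" using r(2) by blast
        then show "y \<in> S" using xc y by (simp flip: m_assoc)
      qed
      then show "\<exists>r>0. D.mball x r \<subseteq> S" by (intro exI[of _ "(1/2)^Suc n"]) simp
    qed
  next
    assume S: "openin D.mtopology S"
    then have Sc: "S \<subseteq> carrier G" using openin_subset D.topspace_mtopology by blast
    show "openin T S"
    proof (subst openin_subopen, intro ballI)
      fix x assume x: "x \<in> S"
      then have xc: "x \<in> carrier G" using Sc by blast
      obtain r where r: "r > 0" "D.mball x r \<subseteq> S"
        using S x unfolding D.openin_mtopology by blast
      obtain n where n: "(1/2)^n < r" using real_arch_pow_inv[OF r(1), of "1/2"] by auto
      \<comment> \<open>Conversely, all points of this translate of the interior of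
        \<open>U n\<close> have distance at most \<open>(1/2)^n < r\<close> from
        \<open>x\<close>.\<close>
      let ?O = "{y \<in> carrier G. inv x \<otimes> y \<in> T interior_of (U n)}"
      have "openin T ?O" by (rule tg_left_translation_nbhd) (use xc in auto)
      moreover have "x \<in> ?O" using xc U(1)[of n] by (simp add: P_def)
      moreover have "?O \<subseteq> S"
      proof
        fix y assume y: "y \<in> ?O"
        then have "inv x \<otimes> y \<in> U n" using interior_of_subset[of T "U n"] by blast
        then have "N (inv x \<otimes> y) < r" using N(2) n by fastforce
        then show "y \<in> S" using r(2) y xc by auto
      qed
      ultimately show "\<exists>T'. openin T T' \<and> x \<in> T' \<and> T' \<subseteq> S" by blast
    qed
  qed
  then have "T = D.mtopology" by (simp add: topology_eq)
  then show thesis using that N(1) by blast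
qed

end

section \<open>A saturated pseudometric space with an action\<close>

text \<open>A cocycle \<^term>\<open>c\<close> on \<^term>\<open>S\<close> encodes the left-invariant pseudometric
  $((g,i),(h,j)) \mapsto c\,i\,j\,(g^{-1}h)$ on the free left \<^term>\<open>G\<close>-set $G \times S$, in which
  \<^term>\<open>g\<close> displaces no point by more than its norm.\<close>
definition cocycle :: "('g, 'b) monoid_scheme \<Rightarrow> ('g \<Rightarrow> real) \<Rightarrow> 'k set \<Rightarrow> ('k \<Rightarrow> 'k \<Rightarrow> 'g \<Rightarrow> real) \<Rightarrow> bool" where
  "cocycle G N S c \<longleftrightarrow>
     (\<forall>i\<in>S. c i i \<one>\<^bsub>G\<^esub> = 0 \<and> (\<forall>x\<in>carrier G. c i i x \<le> N x \<and>
        (\<forall>j\<in>S. c j i (inv\<^bsub>G\<^esub> x) = c i j x \<and>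
          (\<forall>k\<in>S. \<forall>y\<in>carrier G. c i k (x \<otimes>\<^bsub>G\<^esub> y) \<le> c i j x + c j k y))))"

text \<open>A Katetov function on \<open>G \<times> S\<close>: \<open>F k y\<close> is the intended
  distance of a new point from \<open>(y, k)\<close>. The first inequality is the Lipschitz
  condition between \<open>(x, j)\<close> and \<open>(x \<otimes> y, k)\<close>, whose distance is
  \<open>c j k y\<close>.\<close>

definition katetov :: "('g, 'b) monoid_scheme \<Rightarrow> 'k set \<Rightarrow> ('k \<Rightarrow> 'k \<Rightarrow> 'g \<Rightarrow> real) \<Rightarrow> ('k \<Rightarrow> 'g \<Rightarrow> real) \<Rightarrow> bool" where
  "katetov G S c F \<longleftrightarrow>
     (\<forall>j\<in>S. \<forall>k\<in>S. \<forall>x\<in>carrier G. \<forall>y\<in>carrier G. F k (x \<otimes>\<^bsub>G\<^esub> y) \<le> F j x + c j k y \<and>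
        c j k (inv\<^bsub>G\<^esub> x \<otimes>\<^bsub>G\<^esub> y) \<le> F j x + F k y)"

text \<open>The Katetov conditions for values prescribed only at the points
  \<open>(q a, p a)\<close>. An indexed family allows repeated points and has the shape of the tasks
  in the recursion.\<close>

definition katetov_data ::
  "('g, 'b) monoid_scheme \<Rightarrow> 'k set \<Rightarrow> ('k \<Rightarrow> 'k \<Rightarrow> 'g \<Rightarrow> real) \<Rightarrow> 'j set \<Rightarrow>
     ('j \<Rightarrow> 'k) \<Rightarrow> ('j \<Rightarrow> 'g) \<Rightarrow> ('j \<Rightarrow> real) \<Rightarrow> bool" where
  "katetov_data G S c A p q v \<longleftrightarrow>
     (\<forall>a\<in>A. p a \<in> S \<and> q a \<in> carrier G \<and>
        (\<forall>b\<in>A. v a \<le> v b + c (p b) (p a) (inv\<^bsub>G\<^esub> q b \<otimes>\<^bsub>G\<^esub> q a) \<and>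
               c (p b) (p a) (inv\<^bsub>G\<^esub> q b \<otimes>\<^bsub>G\<^esub> q a) \<le> v a + v b))"

text \<open>Reads off a cocycle from the distance functions \<^term>\<open>F i\<close> of the points \<open>(\<one>, i)\<close> to the
  earlier points; two points of the same orbit get the supremum distance of their distance functions.\<close>
definition cocycle_of :: "('g, 'b) monoid_scheme \<Rightarrow> ('g \<Rightarrow> real) \<Rightarrow> 'k set \<Rightarrow>
    ('k \<Rightarrow> 'k \<Rightarrow> 'g \<Rightarrow> real) \<Rightarrow> 'k \<Rightarrow> 'k \<Rightarrow> 'g \<Rightarrow> real" where
  "cocycle_of G N K F i j x =
     (if j \<in> underS |K| i then F i j x
      else if i \<in> underS |K| j then F j i (inv\<^bsub>G\<^esub> x)
      else if underS |K| i = {} then N x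
      else (SUP (k, y)\<in>underS |K| i \<times> carrier G. \<bar>F i k y - F i k (inv\<^bsub>G\<^esub> x \<otimes>\<^bsub>G\<^esub> y)\<bar>))"

lemma cocycleI:
  assumes "\<And>i. i \<in> S \<Longrightarrow> c i i \<one>\<^bsub>G\<^esub> = 0"
    and "\<And>i x. i \<in> S \<Longrightarrow> x \<in> carrier G \<Longrightarrow> c i i x \<le> N x"
    and "\<And>i j x. i \<in> S \<Longrightarrow> j \<in> S \<Longrightarrow> x \<in> carrier G \<Longrightarrow> c j i (inv\<^bsub>G\<^esub> x) = c i j x"
    and "\<And>i j k x y. i \<in> S \<Longrightarrow> j \<in> S \<Longrightarrow> k \<in> S \<Longrightarrow> x \<in> carrier G \<Longrightarrow> y \<in> carrier G \<Longrightarrow>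
      c i k (x \<otimes>\<^bsub>G\<^esub> y) \<le> c i j x + c j k y"
  shows "cocycle G N S c"
  unfolding cocycle_def using assms by (intro ballI conjI)

lemma cocycleD:
  assumes "cocycle G N S c" "i \<in> S"
  shows "c i i \<one>\<^bsub>G\<^esub> = 0"
    and "x \<in> carrier G \<Longrightarrow> c i i x \<le> N x"
    and "j \<in> S \<Longrightarrow> x \<in> carrier G \<Longrightarrow> c j i (inv\<^bsub>G\<^esub> x) = c i j x"
    and "j \<in> S \<Longrightarrow> k \<in> S \<Longrightarrow> x \<in> carrier G \<Longrightarrow> y \<in> carrier G \<Longrightarrow>
      c i k (x \<otimes>\<^bsub>G\<^esub> y) \<le> c i j x + c j k y"
  using assms by (simp_all add: cocycle_def)

lemma cocycle_subset: "cocycle G N S c \<Longrightarrow> R \<subseteq> S \<Longrightarrow> cocycle G N R c"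
  by (rule cocycleI) (auto dest: cocycleD)

lemma cocycle_cong:
  assumes "\<And>i j. i \<in> S \<Longrightarrow> j \<in> S \<Longrightarrow> c i j = c' i j"
  shows "cocycle G N S c \<longleftrightarrow> cocycle G N S c'"
  unfolding cocycle_def using assms by auto

lemma katetov_cong:
  assumes "\<And>i j. i \<in> S \<Longrightarrow> j \<in> S \<Longrightarrow> c i j = c' i j"
  shows "katetov G S c F \<longleftrightarrow> katetov G S c' F"
  unfolding katetov_def using assms by auto

lemma katetov_data_cong:
  assumes "\<And>i j. i \<in> S \<Longrightarrow> j \<in> S \<Longrightarrow> c i j = c' i j"
  shows "katetov_data G S c A p q v \<longleftrightarrow> katetov_data G S c' A p q v"
proof -
  have "katetov_data G S c' A p q v"
    if "katetov_data G S c A p q v" "\<And>i j. i \<in> S \<Longrightarrow> j \<in> S \<Longrightarrow> c i j = c' i j" for c c'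
  proof -
    have "c' (p b) (p a) = c (p b) (p a)" if "a \<in> A" "b \<in> A" for a b
      using \<open>katetov_data G S c A p q v\<close> that \<open>\<And>i j. i \<in> S \<Longrightarrow> j \<in> S \<Longrightarrow> c i j = c' i j\<close>
      by (simp add: katetov_data_def)
    with that(1) show ?thesis by (auto simp: katetov_data_def)
  qed
  from this[of c c'] this[of c' c] assms show ?thesis by auto
qed

section \<open>Extending Katetov functions and adjoining free orbits\<close>

context group
begin

lemma norm_conj_inv:
  assumes "conj_invariant_norm G N" "x \<in> carrier G" "y \<in> carrier G"
  shows "N (inv y \<otimes> (x \<otimes> y)) = N x"
proof -
  have "N (inv y \<otimes> x \<otimes> inv (inv y)) = N x"
    using assms inv_closed unfolding conj_invariant_norm_def by blast
  then show ?thesis using assms by (simp add: m_assoc)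
qed

lemma cocycle_nonneg:
  assumes c: "cocycle G N S c" and "i \<in> S" "j \<in> S" "x \<in> carrier G"
  shows "0 \<le> c i j x"
proof -
  have "c i i (x \<otimes> inv x) \<le> c i j x + c j i (inv x)"
    using assms by (intro cocycleD(4)[OF c]) auto
  moreover have "c j i (inv x) = c i j x" "c i i \<one> = 0"
    using cocycleD(1,3)[OF c] assms by auto
  ultimately show ?thesis using assms by simp
qed

text \<open>Katetov's infimum formula: \<open>F\<close> is the infimum over \<open>a\<close> of
  \<open>v a\<close> plus the distance from \<open>(q a, p a)\<close>. The Lipschitz condition on
  the data makes it agree with \<open>v\<close> at the given points.\<close>

lemma katetov_extension:
  assumes c: "cocycle G N S c" and A: "A \<noteq> {}" and dat: "katetov_data G S c A p q v"
  obtains F where "katetov G S c F" "\<forall>a\<in>A. F (p a) (q a) = v a"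
proof -
  have p: "p a \<in> S" and q: "q a \<in> carrier G" if "a \<in> A" for a
    using dat that by (auto simp: katetov_data_def)
  have v1: "v a \<le> v b + c (p b) (p a) (inv q b \<otimes> q a)"
    and v2: "c (p b) (p a) (inv q b \<otimes> q a) \<le> v a + v b" if "a \<in> A" "b \<in> A" for a b
    using dat that by (auto simp: katetov_data_def)
  note one = cocycleD(1)[OF c] and sym = cocycleD(3)[OF c] and tri = cocycleD(4)[OF c]
  have v0: "0 \<le> v a" if "a \<in> A" for a
    using v2[OF that that] one[OF p[OF that]] q[OF that] by simp
  define F where "F k y = (INF a\<in>A. v a + c (p a) k (inv q a \<otimes> y))" for k y
  have Fle: "F k y \<le> v a + c (p a) k (inv q a \<otimes> y)"
    if "a \<in> A" "k \<in> S" "y \<in> carrier G" for a k y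
    unfolding F_def
  proof (rule cINF_lower[OF _ that(1)])
    show "bdd_below ((\<lambda>a. v a + c (p a) k (inv q a \<otimes> y)) ` A)"
      by (rule bdd_belowI[of _ 0])
        (auto intro!: add_nonneg_nonneg v0 cocycle_nonneg[OF c] p that q)
  qed
  have Fge: "b \<le> F k y" if "\<And>a. a \<in> A \<Longrightarrow> b \<le> v a + c (p a) k (inv q a \<otimes> y)" for b k y
    unfolding F_def by (rule cINF_greatest[OF A that])
  have "F k (x \<otimes> y) \<le> F j x + c j k y"
    if t: "j \<in> S" "k \<in> S" "x \<in> carrier G" "y \<in> carrier G" for j k x y
  proof -
    have "F k (x \<otimes> y) - c j k y \<le> F j x"
    proof (rule Fge)
      fix a assume a: "a \<in> A"
      have "c (p a) k (inv q a \<otimes> x \<otimes> y) \<le> c (p a) j (inv q a \<otimes> x) + c j k y"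
        using tri t p[OF a] q[OF a] by simp
      then show "F k (x \<otimes> y) - c j k y \<le> v a + c (p a) j (inv q a \<otimes> x)"
        using Fle[OF a, of k "x \<otimes> y"] t q[OF a] by (simp add: m_assoc)
    qed
    then show ?thesis by simp
  qed
  moreover have "c j k (inv x \<otimes> y) \<le> F j x + F k y"
    if t: "j \<in> S" "k \<in> S" "x \<in> carrier G" "y \<in> carrier G" for j k x y
  proof -
    have "c j k (inv x \<otimes> y) - F k y \<le> F j x"
    proof (rule Fge)
      fix a assume a: "a \<in> A"
      \<comment> \<open>Both infima are estimated in turn: the route from \<open>(x, j)\<close> to
        \<open>(y, k)\<close> passes through the points of \<open>a\<close> and \<open>b\<close>,
        and \<open>v2\<close> bounds the middle leg.\<close>
      have "c j k (inv x \<otimes> y) - (v a + c (p a) j (inv q a \<otimes> x)) \<le> F k y"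
      proof (rule Fge)
        fix b assume b: "b \<in> A"
        have "c j k (inv x \<otimes> y) \<le> c j (p a) (inv x \<otimes> q a) + c (p a) k (inv q a \<otimes> y)"
          using tri[of j "p a" k "inv x \<otimes> q a" "inv q a \<otimes> y"] t p[OF a] q[OF a] by (simp add: word_simps)
        moreover have "c (p a) k (inv q a \<otimes> y) \<le>
            c (p a) (p b) (inv q a \<otimes> q b) + c (p b) k (inv q b \<otimes> y)"
          using tri[of "p a" "p b" k "inv q a \<otimes> q b" "inv q b \<otimes> y"] t p[OF a] p[OF b] q[OF a] q[OF b]
          by (simp add: word_simps)
        moreover have "c j (p a) (inv x \<otimes> q a) = c (p a) j (inv q a \<otimes> x)"
          using sym[of "p a" j "inv q a \<otimes> x"] t p[OF a] q[OF a] by (simp add: word_simps)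
        ultimately show "c j k (inv x \<otimes> y) - (v a + c (p a) j (inv q a \<otimes> x)) \<le>
            v b + c (p b) k (inv q b \<otimes> y)"
          using v2[OF b a] by linarith
      qed
      then show "c j k (inv x \<otimes> y) - F k y \<le> v a + c (p a) j (inv q a \<otimes> x)" by simp
    qed
    then show ?thesis by simp
  qed
  ultimately have "katetov G S c F" by (simp add: katetov_def)
  moreover have "\<forall>a\<in>A. F (p a) (q a) = v a"
  proof (intro ballI antisym)
    fix a assume a: "a \<in> A"
    show "F (p a) (q a) \<le> v a"
      using Fle[OF a p[OF a] q[OF a]] one[OF p[OF a]] q[OF a] by simp
    show "v a \<le> F (p a) (q a)"
      by (rule Fge) (rule v1[OF a])
  qed
  ultimately show thesis using that by blast
qed

text \<open>The new point \<open>(\<one>, i)\<close> has distance function \<open>F\<close>, and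
  \<open>(x, i)\<close> the translate of \<open>F\<close> by \<open>x\<close>; within the new orbit,
  distances are sup distances of these functions. Invariance of \<open>N\<close> bounds the supremum
  by \<open>N x\<close>, which gives both its finiteness and the displacement bound.\<close>

lemma cocycle_insert:
  assumes N: "conj_invariant_norm G N" and c: "cocycle G N S c" and "S \<noteq> {}" and i: "i \<notin> S"
    and F: "katetov G S c F"
    and c1: "\<And>j x. j \<in> S \<Longrightarrow> x \<in> carrier G \<Longrightarrow> c i j x = F j x"
    and c2: "\<And>j x. j \<in> S \<Longrightarrow> x \<in> carrier G \<Longrightarrow> c j i x = F j (inv x)"
    and c3: "\<And>x. x \<in> carrier G \<Longrightarrow>
      c i i x = (SUP (k, y)\<in>S \<times> carrier G. \<bar>F k y - F k (inv x \<otimes> y)\<bar>)"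
  shows "cocycle G N (insert i S) c"
proof -
  note one = cocycleD(1)[OF c] and cN = cocycleD(2)[OF c]
    and sym = cocycleD(3)[OF c] and tri = cocycleD(4)[OF c]
  have F1: "F k (x \<otimes> y) \<le> F j x + c j k y"
    if "j \<in> S" "k \<in> S" "x \<in> carrier G" "y \<in> carrier G" for j k x y
    using F that by (auto simp: katetov_def)
  have F2: "c j k (inv x \<otimes> y) \<le> F j x + F k y"
    if "j \<in> S" "k \<in> S" "x \<in> carrier G" "y \<in> carrier G" for j k x y
    using F that by (auto simp: katetov_def)
  have Ninv: "N (inv x) = N x" if "x \<in> carrier G" for x
    using N that by (simp add: conj_invariant_norm_def)
  \<comment> \<open>On the right, \<open>y\<close> and \<open>inv x \<otimes> y\<close> differ by a
    conjugate of \<open>x\<close> or of its inverse, so the bound of \<open>c k k\<close> by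
    \<open>N\<close> and conjugation invariance apply.\<close>
  have FN: "\<bar>F k y - F k (inv x \<otimes> y)\<bar> \<le> N x" if t: "k \<in> S" "x \<in> carrier G" "y \<in> carrier G" for k x y
  proof -
    have "F k y \<le> F k (inv x \<otimes> y) + c k k (inv y \<otimes> (x \<otimes> y))"
      using F1[of k k "inv x \<otimes> y" "inv y \<otimes> (x \<otimes> y)"] t by (simp add: word_simps)
    moreover have "c k k (inv y \<otimes> (x \<otimes> y)) \<le> N x"
      using cN[of k "inv y \<otimes> (x \<otimes> y)"] t norm_conj_inv[OF N] by simp
    moreover have "F k (inv x \<otimes> y) \<le> F k y + c k k (inv y \<otimes> (inv x \<otimes> y))"
      using F1[of k k y "inv y \<otimes> (inv x \<otimes> y)"] t by (simp add: word_simps)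
    moreover have "c k k (inv y \<otimes> (inv x \<otimes> y)) \<le> N x"
      using cN[of k "inv y \<otimes> (inv x \<otimes> y)"] t norm_conj_inv[OF N] Ninv by simp
    ultimately show ?thesis by linarith
  qed
  have up: "\<bar>F k y - F k (inv x \<otimes> y)\<bar> \<le> c i i x" if "k \<in> S" "x \<in> carrier G" "y \<in> carrier G" for k x y
  proof -
    have "bdd_above ((\<lambda>(k, y). \<bar>F k y - F k (inv x \<otimes> y)\<bar>) ` (S \<times> carrier G))"
      by (rule bdd_aboveI[of _ "N x"]) (auto intro: FN that(2))
    from cSUP_upper[OF _ this, of "(k, y)"] show ?thesis
      using that by (simp add: c3)
  qed
  have least: "c i i x \<le> b"
    if "x \<in> carrier G" "\<And>k y. k \<in> S \<Longrightarrow> y \<in> carrier G \<Longrightarrow> \<bar>F k y - F k (inv x \<otimes> y)\<bar> \<le> b" for x b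
    unfolding c3[OF that(1)]
    by (rule cSUP_least) (use \<open>S \<noteq> {}\<close> one_closed that in auto)
  have iisym_le: "c i i (inv x) \<le> c i i x" if x: "x \<in> carrier G" for x
  proof (rule least)
    fix k y assume "k \<in> S" "y \<in> carrier G"
    then show "\<bar>F k y - F k (inv (inv x) \<otimes> y)\<bar> \<le> c i i x"
      using up[of k x "x \<otimes> y"] x by (simp add: word_simps abs_minus_commute)
  qed (use x in simp)
  have iisym: "c i i (inv x) = c i i x" if x: "x \<in> carrier G" for x
    using iisym_le[OF x] iisym_le[of "inv x"] x by simp
  have iitri: "c i i (x \<otimes> y) \<le> c i i x + c i i y" if t: "x \<in> carrier G" "y \<in> carrier G" for x y
  proof (rule least)
    fix k z assume k: "k \<in> S" "z \<in> carrier G"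
    have "\<bar>F k z - F k (inv x \<otimes> z)\<bar> \<le> c i i x"
      "\<bar>F k (inv x \<otimes> z) - F k (inv y \<otimes> (inv x \<otimes> z))\<bar> \<le> c i i y"
      using up k t by simp_all
    then show "\<bar>F k z - F k (inv (x \<otimes> y) \<otimes> z)\<bar> \<le> c i i x + c i i y"
      using k t by (simp add: word_simps)
  qed (use t in simp)
  \<comment> \<open>Two new points compared via an old one: two Lipschitz and two sum conditions on
    \<open>F\<close> bound every term of the supremum.\<close>
  have iji: "c i i (x \<otimes> y) \<le> F j x + F j (inv y)" if t: "j \<in> S" "x \<in> carrier G" "y \<in> carrier G" for j x y
  proof (rule least)
    fix k z assume k: "k \<in> S" "z \<in> carrier G"
    let ?z = "inv y \<otimes> (inv x \<otimes> z)"
    have "F k z \<le> F j x + c j k (inv x \<otimes> z)"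
      using F1[of j k x "inv x \<otimes> z"] k t by (simp add: word_simps)
    moreover have "c j k (inv x \<otimes> z) \<le> F j (inv y) + F k ?z"
      using F2[of j k "inv y" ?z] k t by (simp add: word_simps)
    moreover have "F k ?z \<le> F j (inv y) + c j k (inv x \<otimes> z)"
      using F1[of j k "inv y" "inv x \<otimes> z"] k t by (simp add: word_simps)
    moreover have "c j k (inv x \<otimes> z) \<le> F j x + F k z"
      using F2[of j k x z] k t by simp
    ultimately show "\<bar>F k z - F k (inv (x \<otimes> y) \<otimes> z)\<bar> \<le> F j x + F j (inv y)"
      using k t by (simp add: word_simps)
  qed (use t in simp)
  have iik: "F k (x \<otimes> y) \<le> c i i x + F k y" if t: "k \<in> S" "x \<in> carrier G" "y \<in> carrier G" for k x y
    using up[of k x "x \<otimes> y"] t by (simp add: word_simps)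
  have ii0: "c i i \<one> = 0"
  proof (rule antisym)
    show "c i i \<one> \<le> 0" by (rule least) auto
    obtain k where "k \<in> S" using \<open>S \<noteq> {}\<close> by blast
    then show "0 \<le> c i i \<one>" using up[of k \<one> \<one>] by simp
  qed
  have iiN: "c i i x \<le> N x" if "x \<in> carrier G" for x
    by (rule least[OF that FN[OF _ that]])
  have jki: "F j (inv (x \<otimes> y)) \<le> c j k x + F k (inv y)"
    if "j \<in> S" "k \<in> S" "x \<in> carrier G" "y \<in> carrier G" for j k x y
    using F1[of k j "inv y" "inv x"] sym[of j k x] that by (simp add: word_simps)
  have jil: "c j l (x \<otimes> y) \<le> F j (inv x) + F l y"
    if "j \<in> S" "l \<in> S" "x \<in> carrier G" "y \<in> carrier G" for j l x y
    using F2[of j l "inv x" y] that by simp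
  have jii: "F j (inv (x \<otimes> y)) \<le> F j (inv x) + c i i y"
    if "j \<in> S" "x \<in> carrier G" "y \<in> carrier G" for j x y
    using iik[of j "inv y" "inv x"] iisym that by (simp add: word_simps)
  show ?thesis
  proof (rule cocycleI)
    show "c j j \<one> = 0" if "j \<in> insert i S" for j
      using that one ii0 by auto
    show "c j j x \<le> N x" if "j \<in> insert i S" "x \<in> carrier G" for j x
      using that cN iiN by auto
    show "c k j (inv x) = c j k x" if "j \<in> insert i S" "k \<in> insert i S" "x \<in> carrier G" for j k x
      using that sym iisym by (auto simp: c1 c2)
    \<comment> \<open>Eight cases, according to which of the three orbits are the new one; names
      such as \<open>jki\<close> spell the pattern treated.\<close>
    show "c j l (x \<otimes> y) \<le> c j k x + c k l y"
      if "j \<in> insert i S" "k \<in> insert i S" "l \<in> insert i S" "x \<in> carrier G" "y \<in> carrier G"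
      for j k l x y
      using that i
      by (cases "j = i"; cases "k = i"; cases "l = i")
        (simp_all add: c1 c2 tri F1 iitri iji iik jki jil jii)
  qed
qed

text \<open>Each cocycle law involves at most three orbits, and these lie in the closed segment of
  the largest of them.\<close>

lemma cocycle_union:
  assumes S: "S \<subseteq> K" and c: "\<And>i. i \<in> S \<Longrightarrow> cocycle G N (insert i (underS |K| i)) c"
  shows "cocycle G N S c"
proof -
  have max: "\<exists>m\<in>S. {i, j, k} \<subseteq> insert m (underS |K| m)" if t: "i \<in> S" "j \<in> S" "k \<in> S" for i j k
  proof -
    have two: "\<exists>m\<in>S. {i, j} \<subseteq> insert m (underS |K| m)" if "i \<in> S" "j \<in> S" for i j
      using that S underS_card_of_total[of i K j] by auto
    obtain m where m: "m \<in> S" "{i, j} \<subseteq> insert m (underS |K| m)" using two t by meson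
    obtain n where n: "n \<in> S" "{m, k} \<subseteq> insert n (underS |K| n)" using two m(1) t(3) by meson
    have "insert m (underS |K| m) \<subseteq> insert n (underS |K| n)"
      using n(2) underS_card_of_trans[of _ K m n] by auto
    with m n show ?thesis by blast
  qed
  show ?thesis
  proof (rule cocycleI)
    show "c i i \<one> = 0" if "i \<in> S" for i
      using cocycleD(1)[OF c[OF that]] by simp
    show "c i i x \<le> N x" if "i \<in> S" "x \<in> carrier G" for i x
      using cocycleD(2)[OF c[OF that(1)]] that by simp
    show "c j i (inv x) = c i j x" if t: "i \<in> S" "j \<in> S" "x \<in> carrier G" for i j x
    proof -
      obtain m where "m \<in> S" "{i, j, j} \<subseteq> insert m (underS |K| m)" using max t(1,2) by meson
      then show ?thesis using t(3) by (intro cocycleD(3)[OF c]) auto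
    qed
    show "c i k (x \<otimes> y) \<le> c i j x + c j k y"
      if t: "i \<in> S" "j \<in> S" "k \<in> S" "x \<in> carrier G" "y \<in> carrier G" for i j k x y
    proof -
      obtain m where "m \<in> S" "{i, j, k} \<subseteq> insert m (underS |K| m)" using max t(1-3) by meson
      then show ?thesis using t(4,5) by (intro cocycleD(4)[OF c]) auto
    qed
  qed
qed

lemma cocycle_singleton:
  assumes N: "conj_invariant_norm G N" and c: "\<And>x. x \<in> carrier G \<Longrightarrow> c i i x = N x"
  shows "cocycle G N {i} c"
  using N c by (auto simp: cocycle_def conj_invariant_norm_def)

text \<open>Stage \<open>i\<close> adds a free orbit whose Katetov function solves the task
  scheduled there. For data over \<open>underS |K| m\<close>, the orbits involved are bounded by
  some \<open>u\<close> (\<open>small_family_bounded\<close>), and bookkeeping supplies a stage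
  beyond \<open>u\<close>, where all of them are already present.\<close>

lemma saturated_cocycle:
  fixes K :: "'k set"
  assumes K: "uncountable K" "sup_power_below_eq K" and N: "conj_invariant_norm G N"
    and cG: "|carrier G| \<le>o |K|"
  obtains c i0 where "i0 \<in> K" "cocycle G N K c" "\<forall>x\<in>carrier G. c i0 i0 x = N x"
    "\<forall>m\<in>K. \<forall>p q v. katetov_data G K c (underS |K| m) p q v \<longrightarrow>
       (\<exists>i\<in>K. \<forall>a\<in>underS |K| m. c i (p a) (q a) = v a)"
proof -
  have inf: "infinite K" by (rule uncountable_infinite[OF K(1)])
  define Z where "Z = (K \<times> carrier G) \<times> (UNIV :: real set)"
  have Zle: "|Z| \<le>o |K|"
    unfolding Z_def
    by (intro card_of_Times_ordLeq[OF inf] card_of_real_ordLeq[OF K] cG card_of_mono1 order.refl)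
  have Zne: "Z \<noteq> {}"
    using infinite_imp_nonempty[OF inf] one_closed by (auto simp: Z_def)
  obtain l s where book: "\<forall>m\<in>K. \<forall>u\<in>K. \<forall>t. (\<forall>j\<in>underS |K| m. t j \<in> Z) \<longrightarrow>
      (\<exists>i\<in>K. u \<in> underS |K| i \<and> l i = m \<and> (\<forall>j\<in>underS |K| m. s i j = t j))"
    by (rule cofinal_bookkeeping[OF inf K(2) Zle Zne])
  \<comment> \<open>Scheduled families are arbitrary; \<open>dat\<close> tells whether the one for
    stage \<open>i\<close> is a nonempty Katetov prescription on the orbits already built.\<close>
  define dat where "dat c i \<longleftrightarrow> underS |K| (l i) \<noteq> {} \<and>
      katetov_data G (underS |K| i) c (underS |K| (l i))
        (\<lambda>a. fst (fst (s i a))) (\<lambda>a. snd (fst (s i a))) (\<lambda>a. snd (s i a))" for c i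
  \<comment> \<open>The cocycle law enters as a premise, so that every stage of the choice has a
    solution; \<open>coc\<close> proves the law afterwards for the chosen \<open>F\<close>.\<close>
  define P where "P F i f \<longleftrightarrow> (let c = cocycle_of G N K F in
      underS |K| i \<noteq> {} \<and> cocycle G N (underS |K| i) c \<longrightarrow> katetov G (underS |K| i) c f \<and>
        (dat c i \<longrightarrow> (\<forall>a\<in>underS |K| (l i). f (fst (fst (s i a))) (snd (fst (s i a))) = snd (s i a))))"
    for F i f
  have "\<exists>F. \<forall>i. P F i (F i)"
  proof (rule dependent_wf_choice[OF wf_underS_card_of[of K]])
    fix F F' :: "'k \<Rightarrow> 'k \<Rightarrow> 'a \<Rightarrow> real" and i f
    assume "\<And>z. (z, i) \<in> {(j, i). j \<in> underS |K| i} \<Longrightarrow> F z = F' z"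
    then have eq: "cocycle_of G N K F j k = cocycle_of G N K F' j k"
      if "j \<in> underS |K| i" "k \<in> underS |K| i" for j k
      using that by (simp add: cocycle_of_def fun_eq_iff)
    show "P F i f = P F' i f"
    proof -
      have "cocycle G N (underS |K| i) (cocycle_of G N K F) =
          cocycle G N (underS |K| i) (cocycle_of G N K F')"
        by (rule cocycle_cong) (rule eq)
      moreover have "katetov G (underS |K| i) (cocycle_of G N K F) f =
          katetov G (underS |K| i) (cocycle_of G N K F') f"
        by (rule katetov_cong) (rule eq)
      moreover have "dat (cocycle_of G N K F) i = dat (cocycle_of G N K F') i"
        unfolding dat_def by (rule arg_cong2[of _ _ _ _ "(\<and>)", OF refl katetov_data_cong]) (rule eq)
      ultimately show ?thesis by (simp only: P_def Let_def)
    qed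
  next
    fix i :: 'k and F
    let ?c = "cocycle_of G N K F"
    show "\<exists>f. P F i f"
    proof (cases "underS |K| i \<noteq> {} \<and> cocycle G N (underS |K| i) ?c")
      case True
      then have c: "cocycle G N (underS |K| i) ?c" by simp
      show ?thesis
      proof (cases "dat ?c i")
        case d: True
        then have ne: "underS |K| (l i) \<noteq> {}"
          and kd: "katetov_data G (underS |K| i) ?c (underS |K| (l i))
            (\<lambda>a. fst (fst (s i a))) (\<lambda>a. snd (fst (s i a))) (\<lambda>a. snd (s i a))"
          unfolding dat_def by blast+
        obtain f where "katetov G (underS |K| i) ?c f"
            "\<forall>a\<in>underS |K| (l i). f (fst (fst (s i a))) (snd (fst (s i a))) = snd (s i a)"
          by (rule katetov_extension[OF c ne kd])
        then show ?thesis by (auto simp: P_def Let_def)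
      next
        case False
        \<comment> \<open>Default when no valid task is scheduled: prescribe distance 0 from
          \<open>(\<one>, k)\<close>, which a pseudometric allows.\<close>
        obtain k where k: "k \<in> underS |K| i" using True by blast
        then have "?c k k \<one> = 0" using c by (simp add: cocycle_def)
        then have kd: "katetov_data G (underS |K| i) ?c {k} (\<lambda>a. a) (\<lambda>_. \<one>) (\<lambda>_. 0)"
          using k by (simp add: katetov_data_def)
        obtain f where "katetov G (underS |K| i) ?c f"
          by (rule katetov_extension[OF c _ kd]) simp
        with False show ?thesis by (auto simp: P_def Let_def)
      qed
    qed (auto simp: P_def)
  qed
  then obtain F where F: "\<And>i. P F i (F i)" by blast
  define c where "c = cocycle_of G N K F"
  have PF: "katetov G (underS |K| i) c (F i)"
    "dat c i \<Longrightarrow> a \<in> underS |K| (l i) \<Longrightarrow> F i (fst (fst (s i a))) (snd (fst (s i a))) = snd (s i a)"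
    if "underS |K| i \<noteq> {}" "cocycle G N (underS |K| i) c" for i a
    using F[of i] that by (auto simp: P_def Let_def c_def)
  have min: "c i i x = N x" if "underS |K| i = {}" "x \<in> carrier G" for i x
    using that by (simp add: c_def cocycle_of_def)
  have coc: "i \<in> K \<Longrightarrow> cocycle G N (insert i (underS |K| i)) c" for i
  proof (induction i rule: wf_induct[OF wf_underS_card_of[of K]])
    case (1 i)
    have S: "cocycle G N (underS |K| i) c"
      by (rule cocycle_union[OF underS_card_of_subset]) (use 1 underS_card_of_subset[of K i] in blast)
    show ?case
    proof (cases "underS |K| i = {}")
      case True
      then show ?thesis using cocycle_singleton[where c = c and i = i, OF N min[OF True]] by simp
    next
      case False
      have ii: "i \<notin> underS |K| i" by (simp add: in_underS_card_of_iff)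
      show ?thesis
      proof (rule cocycle_insert[OF N S False ii PF(1)[OF False S]])
        show "c i j x = F i j x" if "j \<in> underS |K| i" for j x
          using that by (simp add: c_def cocycle_of_def)
        show "c j i x = F i j (inv x)" if "j \<in> underS |K| i" for j x
          using that underS_card_of_asym[OF that] by (simp add: c_def cocycle_of_def)
        show "c i i x = (SUP (k, y)\<in>underS |K| i \<times> carrier G. \<bar>F i k y - F i k (inv x \<otimes> y)\<bar>)" for x
          using False ii by (simp add: c_def cocycle_of_def)
      qed
    qed
  qed
  have cK: "cocycle G N K c"
    by (rule cocycle_union[OF order.refl coc])
  have cS: "cocycle G N (underS |K| i) c" if "i \<in> K" for i
    by (rule cocycle_subset[OF cK underS_card_of_subset])
  \<comment> \<open>The orbit of the least element of \<open>K\<close> carries the norm itself, so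
    it is an isometric copy of \<open>G\<close>.\<close>
  obtain i0 where i0: "i0 \<in> K" "underS |K| i0 = {}"
  proof -
    obtain z where "z \<in> K" using infinite_imp_nonempty[OF inf] by blast
    from wfE_min[OF wf_underS_card_of[of K] this] obtain i where
      "i \<in> K" "\<And>j. (j, i) \<in> {(j, i). j \<in> underS |K| i} \<Longrightarrow> j \<notin> K" by metis
    then have "underS |K| i = {}" using underS_card_of_subset[of K i] by blast
    with \<open>i \<in> K\<close> show thesis by (rule that)
  qed
  have "\<exists>i\<in>K. \<forall>a\<in>underS |K| m. c i (p a) (q a) = v a"
    if m: "m \<in> K" and d: "katetov_data G K c (underS |K| m) p q v" for m p q v
  proof (cases "underS |K| m = {}")
    case True
    then show ?thesis using i0 by blast
  next
    case False
    have pq: "p a \<in> K" "q a \<in> carrier G" if "a \<in> underS |K| m" for a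
      using d that by (auto simp: katetov_data_def)
    obtain u where u: "u \<in> K" "\<And>a. a \<in> underS |K| m \<Longrightarrow> p a = u \<or> p a \<in> underS |K| u"
      using small_family_bounded[OF K(2) card_of_underS_card_of[OF m], of p] pq(1) m by blast
    have "\<forall>a\<in>underS |K| m. ((p a, q a), v a) \<in> Z"
      using pq by (simp add: Z_def)
    then obtain i where i:
      "i \<in> K" "u \<in> underS |K| i" "l i = m" "\<And>a. a \<in> underS |K| m \<Longrightarrow> s i a = ((p a, q a), v a)"
      using book[rule_format, OF m u(1), of "\<lambda>a. ((p a, q a), v a)"] by auto
    have pi: "p a \<in> underS |K| i" if "a \<in> underS |K| m" for a
      using u(2)[OF that] i(2) underS_card_of_trans by metis
    have "dat c i"
      unfolding dat_def katetov_data_def i(3)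
      using False d pi by (simp add: i(4) katetov_data_def)
    then have "F i (p a) (q a) = v a" if "a \<in> underS |K| m" for a
      using PF(2)[of i a] i(2-4) cS[OF i(1)] that by auto
    moreover have "c i (p a) (q a) = F i (p a) (q a)" if "a \<in> underS |K| m" for a
      using pi[OF that] by (simp add: c_def cocycle_of_def)
    ultimately show ?thesis using i(1) by auto
  qed
  with that[OF i0(1) cK] min[OF i0(2)] show thesis by blast
qed

end

section \<open>Extension property and back and forth\<close>

lemma weight_le_mtopology:
  fixes K :: "'k set"
  assumes "Metric_space X e" "|X| \<le>o |K|" "uncountable K"
  shows "weight_le (Metric_space.mtopology X e) K"
proof -
  interpret Metric_space X e by (rule assms(1))
  define B where "B = (\<lambda>(x, n). mball x (inverse (real (Suc n)))) ` (X \<times> UNIV)"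
  have "\<exists>C\<subseteq>B. \<Union>C = U" if U: "openin mtopology U" for U
  proof (intro exI conjI)
    show "{b \<in> B. b \<subseteq> U} \<subseteq> B" by blast
    show "\<Union>{b \<in> B. b \<subseteq> U} = U"
    proof (intro equalityI subsetI)
      fix x assume x: "x \<in> U"
      then obtain r where r: "r > 0" "mball x r \<subseteq> U" and xX: "x \<in> X"
        using U unfolding openin_mtopology by blast
      obtain n where "inverse (real (Suc n)) < r" using reals_Archimedean[OF r(1)] by blast
      then have "mball x (inverse (real (Suc n))) \<subseteq> U"
        using mball_subset_concentric[of "inverse (real (Suc n))" r x] r(2) by simp
      moreover have "mball x (inverse (real (Suc n))) \<in> B"
        using xX by (auto simp: B_def)
      moreover have "x \<in> mball x (inverse (real (Suc n)))" using xX by simp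
      ultimately show "x \<in> \<Union>{b \<in> B. b \<subseteq> U}" by blast
    qed auto
  qed
  moreover have "|B| \<le>o |K|"
  proof -
    have "|X \<times> (UNIV :: nat set)| \<le>o |K|"
      by (rule card_of_Times_ordLeq[OF uncountable_infinite[OF assms(3)] assms(2)
            ordLess_imp_ordLeq[OF nat_ordLess_uncountable[OF assms(3)]]])
    then show ?thesis
      unfolding B_def using card_of_image ordLeq_transitive by blast
  qed
  moreover have "\<forall>U\<in>B. openin mtopology U" by (auto simp: B_def)
  ultimately show ?thesis unfolding weight_le_def by blast
qed

text \<open>The upper bound counts limits of sequences from a dense set; the lower bound applies the
  minimality clause to \<open>M\<close> itself.\<close>

lemma density_eq_card:
  fixes K :: "'k set" and M :: "'a set"
  assumes "Metric_space M d" "density_eq M d K" "uncountable K" "sup_power_below_eq K"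
  shows "|M| \<le>o |K|" "|K| \<le>o |M|"
proof -
  interpret Metric_space M d by (rule assms(1))
  obtain D where "mtopology closure_of D = M" "|D| =o |K|"
    using assms(2) by (auto simp: density_eq_def)
  then show "|M| \<le>o |K|"
    using card_of_metrizable_ordLeq[OF assms(3,4) metrizable_space_mtopology, of D]
    by (simp add: ordIso_imp_ordLeq)
  show "|K| \<le>o |M|"
    using assms(2) closure_of_topspace[of mtopology] by (simp add: density_eq_def)
qed

text \<open>A Katetov function supplies the distances of a new point. The absolute values matter
  only off \<open>Y\<close>, where \<open>f\<close> may be negative although nonnegativity is
  demanded for all arguments.\<close>

lemma one_point_extension:
  assumes "Metric_space M d" and Y: "Y \<subseteq> M" and z: "z \<notin> Y"
    and f: "\<And>y. y \<in> Y \<Longrightarrow> 0 < f y"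
    and k1: "\<And>x y. x \<in> Y \<Longrightarrow> y \<in> Y \<Longrightarrow> f x \<le> f y + d x y"
    and k2: "\<And>x y. x \<in> Y \<Longrightarrow> y \<in> Y \<Longrightarrow> d x y \<le> f x + f y"
  shows "Metric_space (insert z Y)
    (\<lambda>x y. if x = z \<and> y = z then 0 else if x = z then \<bar>f y\<bar> else if y = z then \<bar>f x\<bar> else d x y)"
proof -
  interpret Metric_space M d by (rule assms(1))
  show ?thesis
  proof (unfold_locales, goal_cases)
    case (1 x y)
    then show ?case by simp
  next
    case (2 x y)
    then show ?case by (simp add: commute)
  next
    case (3 x y)
    then show ?case using f Y zero by (auto simp: subset_iff) (metis less_irrefl)+
  next
    case (4 x y w)
    have tri: "d x w \<le> d x y + d y w" if "x \<in> Y" "y \<in> Y" "w \<in> Y" for x y w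
      using that Y by (intro triangle) auto
    have abs: "\<bar>f y\<bar> = f y" if "y \<in> Y" for y using f[OF that] by simp
    show ?case
      using 4 z tri[of x y w] k1[of w y] k1[of x y] k2[of x w] f[of y] abs commute[of w y]
      by (cases "x = z"; cases "y = z"; cases "w = z") auto
  qed
qed

text \<open>The one-point extension described by \<open>v\<close> embeds into \<open>M\<close> by
  universality, and homogeneity moves the image of the old points back into place; the image of the
  new point then has exactly the distances \<open>v\<close>.\<close>

lemma urysohn_katetov_saturated:
  fixes K :: "'k set" and M :: "'a set"
  assumes U: "urysohn_katetov K M d" and K: "uncountable K" "sup_power_below_eq K"
    and J: "|J| <o |K|" and p: "\<And>a. a \<in> J \<Longrightarrow> p a \<in> M"
    and v1: "\<And>a b. a \<in> J \<Longrightarrow> b \<in> J \<Longrightarrow> v a \<le> v b + d (p a) (p b)"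
    and v2: "\<And>a b. a \<in> J \<Longrightarrow> b \<in> J \<Longrightarrow> d (p a) (p b) \<le> v a + v b"
  obtains x where "x \<in> M" "\<forall>a\<in>J. d x (p a) = v a"
proof -
  have MS: "Metric_space M d" and dens: "density_eq M d K"
    using U by (auto simp: urysohn_katetov_def)
  interpret Metric_space M d by (rule MS)
  note card = density_eq_card[OF MS dens K]
  have universal: "\<forall>(X :: 'a set) e. Metric_space X e \<and> weight_le (Metric_space.mtopology X e) K \<longrightarrow>
        (\<exists>f. f ` X \<subseteq> M \<and> (\<forall>x\<in>X. \<forall>y\<in>X. d (f x) (f y) = e x y))"
    using U unfolding urysohn_katetov_def by (elim conjE)
  have homogeneous: "\<forall>A h. A \<subseteq> M \<and> |A| <o |K| \<and> h ` A \<subseteq> M \<and> (\<forall>x\<in>A. \<forall>y\<in>A. d (h x) (h y) = d x y) \<longrightarrow>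
        (\<exists>F. bij_betw F M M \<and> (\<forall>x\<in>M. \<forall>y\<in>M. d (F x) (F y) = d x y) \<and> (\<forall>x\<in>A. F x = h x))"
    using U unfolding urysohn_katetov_def by (elim conjE)
  have v0: "0 \<le> v a" if "a \<in> J" for a
    using v2[OF that that] p[OF that] by simp
  show thesis
  proof (cases "\<exists>a\<in>J. v a = 0")
    \<comment> \<open>A zero value already determines the solution \<open>p a\<close>. In the other
      case all values are positive, so that the one-point extension is a genuine metric
      space.\<close>
    case True
    then obtain a where a: "a \<in> J" "v a = 0" by blast
    have "d (p a) (p b) = v b" if "b \<in> J" for b
      using v1[OF that a(1)] v2[OF a(1) that] a(2) commute[of "p a" "p b"] by simp
    then show thesis using that p a(1) by blast
  next
    case False
    then have vpos: "0 < v a" if "a \<in> J" for a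
      using v0[OF that] that by (metis order_le_less)
    \<comment> \<open>Universality is stated for carriers in the type of \<open>M\<close>, so the
      new point needs a name there: any \<open>z\<close> outside the small set of the
      \<open>p a\<close> will do, wherever it sits in \<open>M\<close>.\<close>
    have "\<not> M \<subseteq> p ` J"
    proof
      assume "M \<subseteq> p ` J"
      then have "|M| \<le>o |J|" by (rule surj_imp_ordLeq)
      then have "|M| <o |K|" using J ordLeq_ordLess_trans by blast
      then show False using card(2) not_ordLess_ordLeq by blast
    qed
    then obtain z where z: "z \<in> M" "z \<notin> p ` J" by blast
    define Y where "Y = p ` J"
    define f where "f y = v (inv_into J p y)" for y
    have YM: "Y \<subseteq> M" using p by (auto simp: Y_def)
    have zY: "z \<notin> Y" using z(2) by (simp add: Y_def)
    have inv: "inv_into J p y \<in> J" "p (inv_into J p y) = y" if "y \<in> Y" for y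
      using that by (auto simp: Y_def inv_into_into f_inv_into_f)
    \<comment> \<open>Indices with the same point have the same value, by \<open>v1\<close> in both
      directions, so \<open>f\<close> does not depend on the choice made by
      \<open>inv_into\<close>.\<close>
    have fp: "f (p a) = v a" if "a \<in> J" for a
    proof -
      have "p a \<in> Y" using that by (simp add: Y_def)
      from inv[OF this] v1[of a "inv_into J p (p a)"] v1[of "inv_into J p (p a)" a] that p[OF that]
      show ?thesis by (simp add: f_def)
    qed
    let ?e = "\<lambda>x y. if x = z \<and> y = z then 0 else if x = z then \<bar>f y\<bar> else if y = z then \<bar>f x\<bar> else d x y"
    have E: "Metric_space (insert z Y) ?e"
    proof (rule one_point_extension[OF MS YM zY])
      show "0 < f y" if "y \<in> Y" for y using vpos inv[OF that] by (simp add: f_def)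
      show "f x \<le> f y + d x y" "d x y \<le> f x + f y" if "x \<in> Y" "y \<in> Y" for x y
        using v1[OF inv(1)[OF that(1)] inv(1)[OF that(2)]] v2[OF inv(1)[OF that(1)] inv(1)[OF that(2)]]
          inv(2)[OF that(1)] inv(2)[OF that(2)] by (simp_all add: f_def)
    qed
    have "insert z Y \<subseteq> M" using z YM by blast
    then have "|insert z Y| \<le>o |K|"
      using card(1) card_of_mono1 ordLeq_transitive by blast
    from weight_le_mtopology[OF E this K(1)]
    have "weight_le (Metric_space.mtopology (insert z Y) ?e) K" .
    with E have "\<exists>g. g ` insert z Y \<subseteq> M \<and> (\<forall>x\<in>insert z Y. \<forall>y\<in>insert z Y. d (g x) (g y) = ?e x y)"
      by (intro universal[THEN spec, THEN spec, THEN mp] conjI)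
    then obtain g where gM: "g ` insert z Y \<subseteq> M"
        and g: "\<And>x y. x \<in> insert z Y \<Longrightarrow> y \<in> insert z Y \<Longrightarrow> d (g x) (g y) = ?e x y"
      by blast
    have gY: "d (g x) (g y) = d x y" if "x \<in> Y" "y \<in> Y" for x y
      using g[of x y] that zY by auto
    have inj: "inj_on g Y"
    proof (rule inj_onI)
      fix x y assume xy: "x \<in> Y" "y \<in> Y" "g x = g y"
      then have "d x y = d (g x) (g x)" using gY[of x y] by simp
      also have "\<dots> = 0" using gM xy(1) by (intro iffD2[OF zero]) auto
      finally show "x = y" using iffD1[OF zero, of x y] xy YM by blast
    qed
    have "|g ` Y| <o |K|"
      unfolding Y_def image_image using card_of_image J ordLeq_ordLess_trans by blast
    moreover have "g ` Y \<subseteq> M" using gM by blast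
    moreover have "inv_into Y g ` (g ` Y) \<subseteq> M"
      using YM inj by (auto simp: inv_into_f_f)
    moreover have "\<forall>x\<in>g ` Y. \<forall>y\<in>g ` Y. d (inv_into Y g x) (inv_into Y g y) = d x y"
      using inj by (auto simp: inv_into_f_f gY)
    \<comment> \<open>Homogeneity is applied to the inverse of \<open>g\<close>, a partial isometry
      from the image of \<open>Y\<close> back to \<open>Y\<close>.\<close>
    ultimately have "\<exists>F. bij_betw F M M \<and> (\<forall>x\<in>M. \<forall>y\<in>M. d (F x) (F y) = d x y) \<and>
        (\<forall>x\<in>g ` Y. F x = inv_into Y g x)"
      by (intro homogeneous[THEN spec, THEN spec, THEN mp] conjI)
    then obtain F where F: "bij_betw F M M" "\<forall>x\<in>M. \<forall>y\<in>M. d (F x) (F y) = d x y"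
        "\<forall>x\<in>g ` Y. F x = inv_into Y g x"
      by (elim exE conjE)
    show thesis
    proof (rule that)
      show "F (g z) \<in> M" using F(1) gM bij_betwE by blast
      show "\<forall>a\<in>J. d (F (g z)) (p a) = v a"
      proof
        fix a assume a: "a \<in> J"
        then have pY: "p a \<in> Y" by (simp add: Y_def)
        then have "F (g (p a)) = p a" using F(3) inj by (simp add: inv_into_f_f)
        then have "d (F (g z)) (p a) = d (F (g z)) (F (g (p a)))" by simp
        also have "\<dots> = d (g z) (g (p a))" using F(2) gM pY by blast
        also have "\<dots> = \<bar>f (p a)\<bar>" using g[of z "p a"] pY zY by auto
        also have "\<dots> = v a" using fp[OF a] vpos[OF a] by simp
        finally show "d (F (g z)) (p a) = v a" .
      qed
    qed
  qed
qed

section \<open>Matching the saturated pseudometric space with the Urysohn-Katetov space\<close>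

context group
begin

text \<open>Back and forth along \<^term>\<open>K\<close> between \<^term>\<open>M\<close> and the pseudometric space
  $G \times K$ given by \<^term>\<open>c\<close>; stage \<^term>\<open>k\<close> treats the point \<open>\<tau> k\<close>.\<close>
lemma back_and_forth:
  fixes K :: "'k set" and M :: "'m set"
  assumes U: "urysohn_katetov K M d" and K: "uncountable K" "sup_power_below_eq K"
    and cG: "|carrier G| \<le>o |K|" and c: "cocycle G N K c"
    and sat: "\<forall>m\<in>K. \<forall>p q v. katetov_data G K c (underS |K| m) p q v \<longrightarrow>
       (\<exists>i\<in>K. \<forall>a\<in>underS |K| m. c i (p a) (q a) = v a)"
  obtains \<pi> where "\<forall>g\<in>carrier G. \<forall>i\<in>K. \<pi> g i \<in> M"
    "\<forall>g\<in>carrier G. \<forall>h\<in>carrier G. \<forall>i\<in>K. \<forall>j\<in>K. d (\<pi> g i) (\<pi> h j) = c i j (inv g \<otimes> h)"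
    "\<forall>x\<in>M. \<exists>g\<in>carrier G. \<exists>i\<in>K. \<pi> g i = x"
proof -
  have MS: "Metric_space M d" and dens: "density_eq M d K"
    using U by (auto simp: urysohn_katetov_def)
  interpret Metric_space M d by (rule MS)
  note card = density_eq_card[OF MS dens K]
  have inf: "infinite K" by (rule uncountable_infinite[OF K(1)])
  note one = cocycleD(1)[OF c] and sym = cocycleD(3)[OF c] and tri = cocycleD(4)[OF c]
  \<comment> \<open>A disjoint sum lets a single enumeration by \<open>K\<close> schedule both the
    forth and the back stages.\<close>
  have "|carrier G \<times> K| \<le>o |K|"
    by (rule card_of_Times_ordLeq[OF inf cG]) (rule card_of_mono1[OF order.refl])
  then have "|M <+> (carrier G \<times> K)| \<le>o |K|"
    by (rule card_of_Plus_ordLeq[OF inf card(1)])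
  moreover have "M <+> (carrier G \<times> K) \<noteq> {}"
    using infinite_imp_nonempty[OF inf] one_closed by auto
  ultimately have "\<exists>\<tau>. \<tau> ` K = M <+> (carrier G \<times> K)"
    by (simp add: card_of_ordLeq2)
  then obtain \<tau> where \<tau>: "\<tau> ` K = M <+> (carrier G \<times> K)" by (elim exE)
  \<comment> \<open>\<open>P k = (x, g, i)\<close> matches \<open>x\<close> in \<open>M\<close> with
    the point \<open>(g, i)\<close>: one side is dictated by \<open>\<tau> k\<close>, and the
    distances to all earlier pairs agree exactly.\<close>
  define Q where "Q P k t \<longleftrightarrow> (k \<in> K \<longrightarrow> fst t \<in> M \<and> fst (snd t) \<in> carrier G \<and> snd (snd t) \<in> K \<and>
      (\<tau> k = Inl (fst t) \<or> \<tau> k = Inr (snd t)) \<and>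
      (\<forall>j\<in>underS |K| k. d (fst t) (fst (P j)) =
        c (snd (snd t)) (snd (snd (P j))) (inv (fst (snd t)) \<otimes> fst (snd (P j)))))"
    for P :: "'k \<Rightarrow> 'm \<times> 'a \<times> 'k" and k t
  have isometric: "d (fst (P a)) (fst (P b)) =
      c (snd (snd (P a))) (snd (snd (P b))) (inv (fst (snd (P a))) \<otimes> fst (snd (P b)))"
    if P: "\<And>j. j \<in> S \<Longrightarrow> Q P j (P j)" and S: "S \<subseteq> K" and ab: "a \<in> S" "b \<in> S" for P S a b
  proof -
    have mem: "fst (P j) \<in> M" "fst (snd (P j)) \<in> carrier G" "snd (snd (P j)) \<in> K" if "j \<in> S" for j
      using P[OF that] S that by (auto simp: Q_def)
    have less: "d (fst (P a)) (fst (P b)) =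
        c (snd (snd (P a))) (snd (snd (P b))) (inv (fst (snd (P a))) \<otimes> fst (snd (P b)))"
      if "a \<in> S" "b \<in> underS |K| a" for a b
      using P[OF that(1)] S that by (auto simp: Q_def)
    consider "a = b" | "b \<in> underS |K| a" | "a \<in> underS |K| b"
      using underS_card_of_total[of a K b] ab S by blast
    then show ?thesis
    proof cases
      case 1
      then show ?thesis using mem[OF ab(1)] one by simp
    next
      case 2
      then show ?thesis by (rule less[OF ab(1)])
    next
      case 3
      have "d (fst (P a)) (fst (P b)) = d (fst (P b)) (fst (P a))" by (rule commute)
      also have "\<dots> = c (snd (snd (P b))) (snd (snd (P a))) (inv (fst (snd (P b))) \<otimes> fst (snd (P a)))"
        by (rule less[OF ab(2) 3])
      also have "\<dots> = c (snd (snd (P a))) (snd (snd (P b)))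
          (inv (inv (fst (snd (P b))) \<otimes> fst (snd (P a))))"
        by (rule sym[symmetric]) (use mem[OF ab(1)] mem[OF ab(2)] in auto)
      finally show ?thesis
        using mem[OF ab(1)] mem[OF ab(2)] by (simp add: inv_mult_group)
    qed
  qed
  have "\<exists>P. \<forall>k. Q P k (P k)"
  proof (rule dependent_wf_choice[OF wf_underS_card_of[of K]])
    fix P P' :: "'k \<Rightarrow> 'm \<times> 'a \<times> 'k" and k t
    assume "\<And>z. (z, k) \<in> {(j, i). j \<in> underS |K| i} \<Longrightarrow> P z = P' z"
    then show "Q P k t = Q P' k t" by (simp add: Q_def)
  next
    fix k and P :: "'k \<Rightarrow> 'm \<times> 'a \<times> 'k"
    assume IH: "\<And>j. (j, k) \<in> {(j, i). j \<in> underS |K| i} \<Longrightarrow> Q P j (P j)"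
    define x where "x j = fst (P j)" for j
    define h where "h j = fst (snd (P j))" for j
    define i where "i j = snd (snd (P j))" for j
    show "\<exists>t. Q P k t"
    proof (cases "k \<in> K")
      case k: True
      have mem: "x j \<in> M" "h j \<in> carrier G" "i j \<in> K" if "j \<in> underS |K| k" for j
        using IH[of j] that underS_card_of_subset[of K k] by (auto simp: Q_def x_def h_def i_def)
      have iso: "d (x a) (x b) = c (i a) (i b) (inv (h a) \<otimes> h b)"
        if "a \<in> underS |K| k" "b \<in> underS |K| k" for a b
        unfolding x_def h_def i_def
        by (rule isometric[OF _ underS_card_of_subset that]) (simp add: IH)
      have "\<tau> k \<in> M <+> (carrier G \<times> K)" using \<tau> k by blast
      then consider y where "y \<in> M" "\<tau> k = Inl y"
        | g l where "g \<in> carrier G" "l \<in> K" "\<tau> k = Inr (g, l)" by auto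
      then show ?thesis
      proof cases
        case (1 y)
        \<comment> \<open>Forth: the distances of \<open>y\<close> from the earlier points of
          \<open>M\<close> are Katetov data on their partners, so saturation yields a matching point
          \<open>(\<one>, l)\<close>.\<close>
        have "katetov_data G K c (underS |K| k) i h (\<lambda>a. d y (x a))"
          unfolding katetov_data_def
        proof (intro ballI conjI)
          fix a b assume a: "a \<in> underS |K| k" and b: "b \<in> underS |K| k"
          show "i a \<in> K" "h a \<in> carrier G" using mem[OF a] by auto
          show "d y (x a) \<le> d y (x b) + c (i b) (i a) (inv (h b) \<otimes> h a)"
            "c (i b) (i a) (inv (h b) \<otimes> h a) \<le> d y (x a) + d y (x b)"
            using triangle[of y "x b" "x a"] triangle[of "x b" y "x a"] commute[of "x b" y]
              mem(1)[OF a] mem(1)[OF b] 1 by (simp_all flip: iso[OF b a])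
        qed
        then obtain l where "l \<in> K" "\<forall>a\<in>underS |K| k. c l (i a) (h a) = d y (x a)"
          using sat k by blast
        then have "Q P k (y, \<one>, l)"
          using 1 mem by (simp add: Q_def x_def h_def i_def)
        then show ?thesis by blast
      next
        case (2 g l)
        \<comment> \<open>Back: the distances of \<open>(g, l)\<close> from the earlier partners are
          realised by a point of \<open>M\<close>.\<close>
        obtain z where "z \<in> M" "\<forall>a\<in>underS |K| k. d z (x a) = c l (i a) (inv g \<otimes> h a)"
        proof (rule urysohn_katetov_saturated[OF U K card_of_underS_card_of[OF k], of x
              "\<lambda>a. c l (i a) (inv g \<otimes> h a)"])
          fix a assume a: "a \<in> underS |K| k"
          show "x a \<in> M" by (rule mem[OF a])
          fix b assume b: "b \<in> underS |K| k"
          have ab: "d (x a) (x b) = c (i b) (i a) (inv (h b) \<otimes> h a)"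
            using iso[OF b a] commute[of "x a" "x b"] by simp
          show "c l (i a) (inv g \<otimes> h a) \<le> c l (i b) (inv g \<otimes> h b) + d (x a) (x b)"
            using tri[of l "i b" "i a" "inv g \<otimes> h b" "inv (h b) \<otimes> h a"] mem[OF a] mem[OF b] 2(1,2)
            by (simp add: ab word_simps)
          show "d (x a) (x b) \<le> c l (i a) (inv g \<otimes> h a) + c l (i b) (inv g \<otimes> h b)"
            using tri[of "i b" l "i a" "inv (h b) \<otimes> g" "inv g \<otimes> h a"]
              sym[of "l" "i b" "inv g \<otimes> h b"] mem[OF a] mem[OF b] 2(1,2)
            by (simp add: ab word_simps)
        qed
        then have "Q P k (z, g, l)"
          using 2 by (simp add: Q_def x_def h_def i_def)
        then show ?thesis by blast
      qed
    qed (simp add: Q_def)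
  qed
  then obtain P where P: "\<And>k. Q P k (P k)" by blast
  have mem: "fst (P k) \<in> M" "fst (snd (P k)) \<in> carrier G" "snd (snd (P k)) \<in> K"
    and cover: "\<tau> k = Inl (fst (P k)) \<or> \<tau> k = Inr (snd (P k))" if "k \<in> K" for k
    using P[of k] that by (auto simp: Q_def)
  have iso: "d (fst (P a)) (fst (P b)) =
      c (snd (snd (P a))) (snd (snd (P b))) (inv (fst (snd (P a))) \<otimes> fst (snd (P b)))"
    if "a \<in> K" "b \<in> K" for a b
    by (rule isometric[OF P order.refl that])
  have "\<exists>k\<in>K. snd (P k) = (g, i)" if "g \<in> carrier G" "i \<in> K" for g i
  proof -
    have "Inr (g, i) \<in> \<tau> ` K" using \<tau> that by auto
    then obtain k where "k \<in> K" "\<tau> k = Inr (g, i)" by auto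
    then show ?thesis using cover[of k] by auto
  qed
  then obtain \<kappa> where \<kappa>: "\<And>g i. g \<in> carrier G \<Longrightarrow> i \<in> K \<Longrightarrow> \<kappa> g i \<in> K \<and> snd (P (\<kappa> g i)) = (g, i)"
    by metis
  define \<pi> where "\<pi> g i = fst (P (\<kappa> g i))" for g i
  show thesis
  proof (rule that[of \<pi>]; intro ballI)
    show "\<pi> g i \<in> M" if "g \<in> carrier G" "i \<in> K" for g i
      using mem \<kappa>[OF that] by (simp add: \<pi>_def)
    show "d (\<pi> g i) (\<pi> h j) = c i j (inv g \<otimes> h)"
      if "g \<in> carrier G" "h \<in> carrier G" "i \<in> K" "j \<in> K" for g h i j
      using iso[of "\<kappa> g i" "\<kappa> h j"] \<kappa>[OF that(1,3)] \<kappa>[OF that(2,4)] by (simp add: \<pi>_def)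
    fix x assume x: "x \<in> M"
    then have "Inl x \<in> \<tau> ` K" using \<tau> by auto
    then obtain k where k: "k \<in> K" "\<tau> k = Inl x" by auto
    then have Pk: "fst (P k) = x" using cover[of k] by auto
    let ?g = "fst (snd (P k))" and ?i = "snd (snd (P k))"
    have \<kappa>k: "\<kappa> ?g ?i \<in> K" "snd (P (\<kappa> ?g ?i)) = (?g, ?i)" using \<kappa> mem[OF k(1)] by blast+
    \<comment> \<open>The stage that \<open>\<kappa>\<close> picks for this pair may differ from
      \<open>k\<close>, but both points of \<open>M\<close> are matched with the same pair, so their
      distance is 0.\<close>
    have "d (\<pi> ?g ?i) x = c ?i ?i (inv ?g \<otimes> ?g)"
      using iso[OF \<kappa>k(1) k(1)] \<kappa>k(2) by (simp add: \<pi>_def Pk)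
    also have "\<dots> = 0" using mem[OF k(1)] one by simp
    finally have "\<pi> ?g ?i = x"
      using mem(1)[OF \<kappa>k(1)] x by (simp add: \<pi>_def)
    then show "\<exists>g\<in>carrier G. \<exists>i\<in>K. \<pi> g i = x" using mem[OF k(1)] by blast
  qed
qed

end

section \<open>The transported action as a topological embedding\<close>

theorem theorem4p6p4:
  fixes K :: "'k set" and M :: "'a set" and d :: "'a \<Rightarrow> 'a \<Rightarrow> real"
    and G :: "('g, 'b) monoid_scheme" and T :: "'g topology"
  assumes "uncountable K"
    and "sup_power_below_eq K"
    and "urysohn_katetov K M d"
    and "topological_group G T"
    and "metrizable_space T"
    and "SIN G T"
    and "weight_le T K"
  shows "\<exists>\<phi>. \<phi> \<in> hom G (Iso_group M d) \<and> inj_on \<phi> (carrier G) \<and>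
           homeomorphic_map T (subtopology (Iso_top M d) (\<phi> ` carrier G)) \<phi>"
proof -
  note K = assms(1,2) and U = assms(3) and tg = assms(4)
  interpret G: group G using tg by (simp add: topological_group_def)
  have TG: "topspace T = carrier G" using tg by (simp add: topological_group_def)
  have "Metric_space M d" using U by (simp add: urysohn_katetov_def)
  then interpret M: Metric_space M d .
  obtain D where "T closure_of D = topspace T" "|D| \<le>o |K|"
    by (rule weight_le_dense[OF assms(7)])
  then have cG: "|carrier G| \<le>o |K|"
    using card_of_metrizable_ordLeq[OF K assms(5)] by (simp add: TG)
  obtain N where N: "conj_invariant_norm G N"
    and TN: "T = Metric_space.mtopology (carrier G)
      (\<lambda>x y. if x \<in> carrier G \<and> y \<in> carrier G then N (inv\<^bsub>G\<^esub> x \<otimes>\<^bsub>G\<^esub> y) else 0)"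
    by (rule SIN_norm[OF tg assms(6,5)])
  define e where "e x y = (if x \<in> carrier G \<and> y \<in> carrier G then N (inv\<^bsub>G\<^esub> x \<otimes>\<^bsub>G\<^esub> y) else 0)" for x y
  have eN: "e x y = N (inv\<^bsub>G\<^esub> x \<otimes>\<^bsub>G\<^esub> y)" if "x \<in> carrier G" "y \<in> carrier G" for x y
    using that by (simp add: e_def)
  have "Metric_space (carrier G) e"
    using G.Metric_space_norm[OF N] by (simp add: e_def[abs_def])
  then interpret E: Metric_space "carrier G" e .
  have TE: "T = E.mtopology" using TN by (simp add: e_def[abs_def])
  obtain c i0 where i0: "i0 \<in> K" and c: "cocycle G N K c" and cN: "\<forall>x\<in>carrier G. c i0 i0 x = N x"
    and sat: "\<forall>m\<in>K. \<forall>p q v. katetov_data G K c (underS |K| m) p q v \<longrightarrow>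
       (\<exists>i\<in>K. \<forall>a\<in>underS |K| m. c i (p a) (q a) = v a)"
    by (rule G.saturated_cocycle[OF K N cG])
  obtain \<pi> where \<pi>M: "\<forall>g\<in>carrier G. \<forall>i\<in>K. \<pi> g i \<in> M"
    and \<pi>d: "\<forall>g\<in>carrier G. \<forall>h\<in>carrier G. \<forall>i\<in>K. \<forall>j\<in>K.
      d (\<pi> g i) (\<pi> h j) = c i j (inv\<^bsub>G\<^esub> g \<otimes>\<^bsub>G\<^esub> h)"
    and \<pi>s: "\<forall>x\<in>M. \<exists>g\<in>carrier G. \<exists>i\<in>K. \<pi> g i = x"
    by (rule G.back_and_forth[OF U K cG c sat])
  obtain a b where ab: "\<And>x. x \<in> M \<Longrightarrow> a x \<in> carrier G \<and> b x \<in> K \<and> \<pi> (a x) (b x) = x"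
    using \<pi>s by metis
  \<comment> \<open>Left translation on \<open>G \<times> K\<close>, carried over to
    \<open>M\<close> through chosen representatives \<open>(a x, b x)\<close>.\<close>
  define \<phi> where "\<phi> g = (\<lambda>x\<in>M. \<pi> (g \<otimes>\<^bsub>G\<^esub> a x) (b x))" for g
  have \<phi>M: "\<phi> g x \<in> M" if "g \<in> carrier G" "x \<in> M" for g x
    using \<pi>M ab[OF that(2)] that by (simp add: \<phi>_def)
  \<comment> \<open>Independence of the representative: \<open>(a x, b x)\<close> and
    \<open>(h, i)\<close> lie over the same point, hence at distance 0, and left translation
    preserves this distance.\<close>
  have \<phi>\<pi>: "\<phi> g (\<pi> h i) = \<pi> (g \<otimes>\<^bsub>G\<^esub> h) i"
    if g: "g \<in> carrier G" and h: "h \<in> carrier G" and i: "i \<in> K" for g h i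
  proof -
    define x where "x = \<pi> h i"
    have x: "x \<in> M" using \<pi>M h i by (simp add: x_def)
    note abx = ab[OF x]
    have "d (\<phi> g x) (\<pi> (g \<otimes>\<^bsub>G\<^esub> h) i) = c (b x) i (inv\<^bsub>G\<^esub> (g \<otimes>\<^bsub>G\<^esub> a x) \<otimes>\<^bsub>G\<^esub> (g \<otimes>\<^bsub>G\<^esub> h))"
      using \<pi>d abx x g h i by (simp add: \<phi>_def)
    also have "\<dots> = c (b x) i (inv\<^bsub>G\<^esub> (a x) \<otimes>\<^bsub>G\<^esub> h)"
      using abx g h by (simp add: G.word_simps)
    also have "\<dots> = d (\<pi> (a x) (b x)) (\<pi> h i)"
      by (rule \<pi>d[rule_format, symmetric]) (use abx h i in auto)
    also have "\<dots> = 0" using abx x by (simp flip: x_def)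
    finally show ?thesis
      using M.zero[of "\<phi> g x" "\<pi> (g \<otimes>\<^bsub>G\<^esub> h) i"] \<phi>M[OF g x] \<pi>M g h i by (simp add: x_def)
  qed
  have \<phi>mult: "\<phi> (g \<otimes>\<^bsub>G\<^esub> h) x = \<phi> g (\<phi> h x)" if "g \<in> carrier G" "h \<in> carrier G" "x \<in> M" for g h x
  proof -
    have "\<phi> g (\<phi> h x) = \<phi> g (\<pi> (h \<otimes>\<^bsub>G\<^esub> a x) (b x))"
      using that by (simp add: \<phi>_def)
    also have "\<dots> = \<pi> (g \<otimes>\<^bsub>G\<^esub> (h \<otimes>\<^bsub>G\<^esub> a x)) (b x)"
      using that ab by (intro \<phi>\<pi>) auto
    finally show ?thesis using that ab by (simp add: \<phi>_def G.m_assoc)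
  qed
  have \<phi>one: "\<phi> \<one>\<^bsub>G\<^esub> x = x" if "x \<in> M" for x
    using that ab by (simp add: \<phi>_def)
  have \<phi>bij: "bij_betw (\<phi> g) M M" if g: "g \<in> carrier G" for g
  proof (rule bij_betw_byWitness[where f' = "\<phi> (inv\<^bsub>G\<^esub> g)"])
    show "\<forall>x\<in>M. \<phi> (inv\<^bsub>G\<^esub> g) (\<phi> g x) = x" "\<forall>x\<in>M. \<phi> g (\<phi> (inv\<^bsub>G\<^esub> g) x) = x"
      using g by (simp_all flip: \<phi>mult add: \<phi>one)
  qed (use \<phi>M g in auto)
  have \<phi>iso: "d (\<phi> g x) (\<phi> g y) = d x y" if g: "g \<in> carrier G" and x: "x \<in> M" and y: "y \<in> M" for g x y
  proof -
    have "d (\<phi> g x) (\<phi> g y) = c (b x) (b y) (inv\<^bsub>G\<^esub> (g \<otimes>\<^bsub>G\<^esub> a x) \<otimes>\<^bsub>G\<^esub> (g \<otimes>\<^bsub>G\<^esub> a y))"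
      using \<pi>d ab[OF x] ab[OF y] g x y by (simp add: \<phi>_def)
    also have "\<dots> = c (b x) (b y) (inv\<^bsub>G\<^esub> (a x) \<otimes>\<^bsub>G\<^esub> a y)"
      using ab[OF x] ab[OF y] g by (simp add: G.word_simps)
    also have "\<dots> = d (\<pi> (a x) (b x)) (\<pi> (a y) (b y))"
      by (rule \<pi>d[rule_format, symmetric]) (use ab[OF x] ab[OF y] in auto)
    finally show ?thesis using ab[OF x] ab[OF y] by simp
  qed
  have \<phi>carrier: "\<phi> g \<in> carrier (Iso_group M d)" if "g \<in> carrier G" for g
    using \<phi>M \<phi>bij \<phi>iso that by (auto simp: Iso_group_def \<phi>_def)
  \<comment> \<open>\<open>g \<otimes> a x\<close> and \<open>h \<otimes> a x\<close> differ on the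
    right by a conjugate of \<open>inv g \<otimes> h\<close>, so invariance of \<open>N\<close>
    gives a bound independent of \<open>x\<close>. It makes evaluation at each point
    continuous.\<close>
  have displacement: "d (\<phi> g x) (\<phi> h x) \<le> e g h"
    if g: "g \<in> carrier G" and h: "h \<in> carrier G" and x: "x \<in> M" for g h x
  proof -
    have "d (\<phi> g x) (\<phi> h x) = c (b x) (b x) (inv\<^bsub>G\<^esub> (g \<otimes>\<^bsub>G\<^esub> a x) \<otimes>\<^bsub>G\<^esub> (h \<otimes>\<^bsub>G\<^esub> a x))"
      using \<pi>d ab[OF x] g h x by (simp add: \<phi>_def)
    also have "\<dots> \<le> N (inv\<^bsub>G\<^esub> (g \<otimes>\<^bsub>G\<^esub> a x) \<otimes>\<^bsub>G\<^esub> (h \<otimes>\<^bsub>G\<^esub> a x))"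
      using ab[OF x] g h by (intro cocycleD(2)[OF c]) auto
    also have "\<dots> = N (inv\<^bsub>G\<^esub> (a x) \<otimes>\<^bsub>G\<^esub> ((inv\<^bsub>G\<^esub> g \<otimes>\<^bsub>G\<^esub> h) \<otimes>\<^bsub>G\<^esub> a x))"
      using ab[OF x] g h by (simp add: G.word_simps)
    also have "\<dots> = N (inv\<^bsub>G\<^esub> g \<otimes>\<^bsub>G\<^esub> h)"
      using ab[OF x] g h by (intro G.norm_conj_inv[OF N]) auto
    finally show ?thesis using g h by (simp add: eN)
  qed
  define x0 where "x0 = \<pi> \<one>\<^bsub>G\<^esub> i0"
  have x0: "x0 \<in> M" using \<pi>M i0 by (simp add: x0_def)
  \<comment> \<open>On the orbit \<open>i0\<close> the cocycle is \<open>N\<close>, so evaluation at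
    \<open>x0\<close> is isometric in the group element; injectivity and openness both rest on
    this.\<close>
  have orbit: "d (\<phi> g x0) (\<phi> h x0) = e g h" if "g \<in> carrier G" "h \<in> carrier G" for g h
    using that i0 \<pi>d cN by (simp add: x0_def \<phi>\<pi> eN)
  have inj: "inj_on \<phi> (carrier G)"
  proof (rule inj_onI)
    fix g h assume gh: "g \<in> carrier G" "h \<in> carrier G" "\<phi> g = \<phi> h"
    then have "e g h = 0" using orbit[of g h] \<phi>M x0 by simp
    then show "g = h" using gh by simp
  qed
  have hom: "\<phi> \<in> hom G (Iso_group M d)"
  proof (rule homI)
    show "\<phi> g \<in> carrier (Iso_group M d)" if "g \<in> carrier G" for g by (rule \<phi>carrier[OF that])
    show "\<phi> (g \<otimes>\<^bsub>G\<^esub> h) = \<phi> g \<otimes>\<^bsub>Iso_group M d\<^esub> \<phi> h" if "g \<in> carrier G" "h \<in> carrier G" for g h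
    proof
      fix x
      show "\<phi> (g \<otimes>\<^bsub>G\<^esub> h) x = (\<phi> g \<otimes>\<^bsub>Iso_group M d\<^esub> \<phi> h) x"
        using \<phi>mult[OF that] by (cases "x \<in> M") (simp_all add: Iso_group_def compose_def \<phi>_def)
    qed
  qed
  let ?S = "subtopology (Iso_top M d) (\<phi> ` carrier G)"
  have S: "?S = subtopology (product_topology (\<lambda>_. M.mtopology) M) (\<phi> ` carrier G)"
    using \<phi>carrier by (simp add: Iso_top_def subtopology_subtopology Int_absorb1 image_subset_iff)
  have topS: "topspace ?S = \<phi> ` carrier G"
  proof -
    have "\<phi> ` carrier G \<subseteq> (\<Pi>\<^sub>E x\<in>M. M)"
      using \<phi>carrier by (simp add: Iso_group_def image_subset_iff)
    then show ?thesis unfolding S by (simp add: Int_absorb1)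
  qed
  have "homeomorphic_map T ?S \<phi>"
  proof (rule bijective_open_imp_homeomorphic_map)
    have "continuous_map E.mtopology M.mtopology (\<lambda>g. \<phi> g x)" if x: "x \<in> M" for x
      unfolding E.metric_continuous_map[OF M.Metric_space_axioms]
    proof (intro conjI ballI allI impI)
      show "(\<lambda>g. \<phi> g x) ` carrier G \<subseteq> M" using \<phi>M x by blast
      fix g and \<epsilon> :: real assume "g \<in> carrier G" "0 < \<epsilon>"
      then show "\<exists>\<delta>>0. \<forall>h. h \<in> carrier G \<and> e g h < \<delta> \<longrightarrow> d (\<phi> g x) (\<phi> h x) < \<epsilon>"
        using displacement[OF _ _ x] by (intro exI[of _ \<epsilon>]) (meson le_less_trans)
    qed
    then show "continuous_map T ?S \<phi>"
      unfolding S continuous_map_in_subtopology continuous_map_componentwise TE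
      by (auto simp: \<phi>_def)
    show "open_map T ?S \<phi>"
      unfolding open_map_def
    proof (intro allI impI)
      fix V assume V: "openin T V"
      then have VG: "V \<subseteq> carrier G" using openin_subset TG by blast
      show "openin ?S (\<phi> ` V)"
      proof (subst openin_subopen, intro ballI)
        fix f assume "f \<in> \<phi> ` V"
        then obtain g where g: "g \<in> V" "f = \<phi> g" by blast
        then obtain r where r: "r > 0" "E.mball g r \<subseteq> V"
          using V unfolding TE E.openin_mtopology by blast
        have gG: "g \<in> carrier G" using g VG by blast
        \<comment> \<open>Evaluation at the single point \<open>x0\<close> suffices: the preimage of
          the ball consists of those \<open>\<phi> h\<close> with \<open>e g h < r\<close>.\<close>
        have "continuous_map ?S M.mtopology (\<lambda>f. f x0)"
          unfolding S by (intro continuous_map_from_subtopology continuous_map_product_projection x0)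
        then have "openin ?S {f \<in> topspace ?S. f x0 \<in> M.mball (\<phi> g x0) r}"
          by (rule openin_continuous_map_preimage) simp
        moreover have "f \<in> {f \<in> topspace ?S. f x0 \<in> M.mball (\<phi> g x0) r}"
          unfolding topS using g gG r(1) \<phi>M[OF gG x0] by simp
        moreover have "{f \<in> topspace ?S. f x0 \<in> M.mball (\<phi> g x0) r} \<subseteq> \<phi> ` V"
        proof
          fix f' assume "f' \<in> {f \<in> topspace ?S. f x0 \<in> M.mball (\<phi> g x0) r}"
          then obtain h where h: "h \<in> carrier G" "f' = \<phi> h" "d (\<phi> g x0) (\<phi> h x0) < r"
            unfolding topS by auto
          then have "h \<in> E.mball g r" using gG orbit by simp
          then show "f' \<in> \<phi> ` V" using r(2) h(2) by blast
        qed
        ultimately show "\<exists>W. openin ?S W \<and> f \<in> W \<and> W \<subseteq> \<phi> ` V" by blast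
      qed
    qed
    show "\<phi> ` topspace T = topspace ?S" by (simp only: topS TG)
    show "inj_on \<phi> (topspace T)" using inj by (simp add: TG)
  qed
  with hom inj show ?thesis by blast
qed

end
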